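(* Let $\Delta_T\to0$ as $T\to\infty$. Then for every $\vartheta\in\Theta$ the family $(\mathcal E^{T,\Delta_T})_{T>0}$ satisfies the LAN property at $\vartheta$ with normalisation $I_{T,0}(\vartheta)=T/\vartheta$. Moreover $I_{T,0}(\vartheta)=\lim_{\Delta\to0}T\Delta\,\varphi(\vartheta,\Delta)$.
   Context: Model: $\Theta\subseteq(0,\infty)$ is an open parameter set. Under $\mathbb P_\vartheta$, $X_t=\sum_{i=1}^{N_t}\varepsilon_i$ ($X_0=0$), where $(N_t)$ is a homogeneous Poisson process of intensity $\vartheta$ and the $\varepsilon_i$ are i.i.d., independent of $(N_t)$, with $\mathbb P(\varepsilon_i=1)=\mathbb P(\varepsilon_i=-1)=1/2$. For $T>0$ and $0<\Delta\le T$, the experiment $\mathcal E^{T,\Delta}=\{\mathbb P^{T,\Delta}_\vartheta,\vartheta\in\Theta\}$ consists of the law of $(X_0,X_\Delta,\dots,X_{\lfloor T/\Delta\rfloor\Delta})$. The increment law is $f_\Delta(\vartheta,k)=e^{-\vartheta\Delta}\mathcal I_{|k|}(\vartheta\Delta)$, $k\in\mathbb Z$, with $\mathcal I_\nu(x)=\sum_{m\ge0}\frac{(x/2)^{2m+\nu}}{m!\,\Gamma(\nu+m+1)}$. Set $h_\Delta(\vartheta,k)=\mathcal I_{|k|+1}(\vartheta\Delta)/\mathcal I_{|k|}(\vartheta\Delta)$ and $\varphi(\vartheta,\Delta)=\mathbb E_\vartheta\big[\big(h_\Delta(\vartheta,X_\Delta)+(\vartheta\Delta)^{-1}|X_\Delta|-1\big)^2\big]$.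 LAN: the family satisfies LAN at $\vartheta$ with normalisation $I_T(\vartheta)>0$ if for every $v$ with $\vartheta+vI_T(\vartheta)^{-1/2}\in\Theta$, $\frac{d\mathbb P^{T,\Delta_T}_{\vartheta+vI_T(\vartheta)^{-1/2}}}{d\mathbb P^{T,\Delta_T}_\vartheta}=\exp(v\xi_T-\tfrac12v^2+r_T)$ with $\xi_T\to\mathcal N(0,1)$ in distribution and $r_T\to0$ in probability under $\mathbb P^{T,\Delta_T}_\vartheta$. *)

theory Defs
  imports "HOL-Probability.Probability"
begin

definition besselI :: "nat \<Rightarrow> real \<Rightarrow> real" where
  "besselI \<nu> x = (\<Sum>m. (x/2) ^ (2*m + \<nu>) / (fact m * Gamma (real \<nu> + real m + 1)))"

definition rademacher_pmf :: "int pmf" where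
  "rademacher_pmf = pmf_of_set {-1, 1}"

definition incr_pmf :: "real \<Rightarrow> real \<Rightarrow> int pmf" where
  "incr_pmf \<theta> \<Delta> =
     bind_pmf (poisson_pmf (\<theta> * \<Delta>)) (\<lambda>n. map_pmf sum_list (replicate_pmf n rademacher_pmf))"

definition f_incr :: "real \<Rightarrow> real \<Rightarrow> int \<Rightarrow> real" where
  "f_incr \<Delta> \<theta> k = exp (-\<theta>*\<Delta>) * besselI (nat \<bar>k\<bar>) (\<theta>*\<Delta>)"

definition h_fun :: "real \<Rightarrow> real \<Rightarrow> int \<Rightarrow> real" where
  "h_fun \<Delta> \<theta> k = besselI (nat \<bar>k\<bar> + 1) (\<theta>*\<Delta>) / besselI (nat \<bar>k\<bar>) (\<theta>*\<Delta>)"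

definition phi :: "real \<Rightarrow> real \<Rightarrow> real" where
  "phi \<theta> \<Delta> = measure_pmf.expectation (incr_pmf \<theta> \<Delta>)
      (\<lambda>k. (h_fun \<Delta> \<theta> k + \<bar>real_of_int k\<bar> / (\<theta>*\<Delta>) - 1)^2)"

definition partial_sums :: "int list \<Rightarrow> int list" where
  "partial_sums xs = map (\<lambda>j. sum_list (take j xs)) [0..<Suc (length xs)]"

(* Law of (X_0, X_Delta, ..., X_{floor(T/Delta) Delta}) under P_theta:
   independent increments, each distributed as X_Delta *)
definition obs_pmf :: "real \<Rightarrow> real \<Rightarrow> real \<Rightarrow> int list pmf" where
  "obs_pmf T \<Delta> \<theta> = map_pmf partial_sums (replicate_pmf (nat \<lfloor>T / \<Delta>\<rfloor>) (incr_pmf \<theta> \<Delta>))"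

(* convergence in distribution as T \<rightarrow> \<infinity> (cdf convergence at continuity points,
   as in the library's weak_conv_m, but along the filter at_top on the reals) *)
definition conv_distr_at_top :: "(real \<Rightarrow> real measure) \<Rightarrow> real measure \<Rightarrow> bool" where
  "conv_distr_at_top M M0 \<longleftrightarrow>
     (\<forall>x. isCont (cdf M0) x \<longrightarrow> ((\<lambda>T. cdf (M T) x) \<longlongrightarrow> cdf M0 x) at_top)"

definition conv_prob_zero_at_top :: "(real \<Rightarrow> 'a pmf) \<Rightarrow> (real \<Rightarrow> 'a \<Rightarrow> real) \<Rightarrow> bool" where
  "conv_prob_zero_at_top P r \<longleftrightarrow>
     (\<forall>\<epsilon>>0. ((\<lambda>T. measure_pmf.prob (P T) {\<omega>. \<bar>r T \<omega>\<bar> > \<epsilon>}) \<longlongrightarrow> 0) at_top)"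

definition LAN :: "(real \<Rightarrow> real \<Rightarrow> 'a pmf) \<Rightarrow> real set \<Rightarrow> real \<Rightarrow> (real \<Rightarrow> real) \<Rightarrow> bool" where
  "LAN P \<Theta> \<theta> I \<longleftrightarrow>
     (\<forall>T>0. I T > 0) \<and>
     (\<exists>\<xi> :: real \<Rightarrow> 'a \<Rightarrow> real.
        conv_distr_at_top (\<lambda>T. distr (measure_pmf (P T \<theta>)) borel (\<xi> T)) std_normal_distribution \<and>
        (\<forall>v::real. \<exists>r :: real \<Rightarrow> 'a \<Rightarrow> real.
           (\<forall>T>0. \<theta> + v / sqrt (I T) \<in> \<Theta> \<longrightarrow>
              (AE \<omega> in measure_pmf (P T \<theta>).
                 pmf (P T (\<theta> + v / sqrt (I T))) \<omega> / pmf (P T \<theta>) \<omega>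
                   = exp (v * \<xi> T \<omega> - v^2 / 2 + r T \<omega>))) \<and>
           conv_prob_zero_at_top (\<lambda>T. P T \<theta>) r))"

end

(* Write u for the shift of the parameter and Y = |X| for the absolute increment. The
   log-likelihood ratio of one increment is ln (1 + u/theta) * Y + D with |D| <= 2 |u| Delta: the
   prefactor (x/2)^k of the Bessel function I_k(x) yields the first term, and the remaining power
   series in (x/2)^2 has a logarithmic derivative between 0 and 1. Hence the centred sum of
   |X_i| / sqrt (theta T) can serve as the central sequence. It is asymptotically normal by a
   Lyapunov-type estimate of its characteristic function, and the fluctuations of the remainder
   vanish by Chebyshev's inequality. The drift -v^2/2 follows from E[Y^2] = E[X^2] = theta Delta,
   because the likelihood ratio has mean one. *)

theory Submission
  imports Defs "HOL-Real_Asymp.Real_Asymp"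
begin

section \<open>Independent samples\<close>

text \<open>The bound on \<open>D\<close> does not make the sum of the \<open>D\<close> terms small:
  with \<open>n * \<Delta> \<le> T\<close> and \<open>u\<close> of order \<open>1 / sqrt T\<close>,
  it only bounds that sum by a multiple of \<open>sqrt T\<close>. Its variance is of order
  \<open>n * u^2 * \<Delta>^2\<close>, hence of order \<open>\<Delta>\<close>, but its mean cannot
  be estimated term by term. So each log-likelihood ratio \<open>L\<close> is split into its mean
  and a centred part. The mean is read off from \<open>E (exp L) = 1\<close>, expanded to second
  order: only \<open>E (L^2)\<close> is needed, and there \<open>D\<close> occurs multiplied by
  \<open>D\<close> or by \<open>Y\<close>, which costs \<open>u^2 * \<Delta>^2\<close>. The price is
  a cubic Taylor remainder with an exponential weight. It is summed \<open>n\<close> times, so its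
  expectation must carry a factor \<open>\<Delta>\<close>. This is why the weight is dominated by
  \<open>cosh (2 * k) - 1\<close>, which vanishes at \<open>k = 0\<close> and has an explicit mean.
  Every estimate for one increment carries such a factor, so that summation costs at most
  \<open>T\<close>, however fast or slowly \<open>\<Delta>\<close> tends to 0.\<close>

lemma indep_var_pair_pmf:
  fixes f :: "'a \<Rightarrow> 'c::topological_space" and g :: "'b \<Rightarrow> 'c"
  shows "prob_space.indep_var (measure_pmf (pair_pmf p q)) borel (\<lambda>z. f (fst z)) borel (\<lambda>z. g (snd z))"
proof -
  let ?P = "measure_pmf (pair_pmf p q)"
  have 1: "measure ?P ((\<lambda>z. f (fst z)) -` A \<inter> (\<lambda>z. g (snd z)) -` B)
      = measure p (f -` A) * measure q (g -` B)" for A B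
  proof -
    have "emeasure ?P ((f -` A) \<times> (g -` B)) = (\<integral>\<^sup>+x. indicator ((f -` A) \<times> (g -` B)) x \<partial>pair_pmf p q)"
      by simp
    also have "\<dots> = (\<integral>\<^sup>+a. \<integral>\<^sup>+b. indicator (f -` A) a * indicator (g -` B) b \<partial>q \<partial>p)"
      unfolding nn_integral_pair_pmf' by (simp add: indicator_times)
    also have "\<dots> = emeasure p (f -` A) * emeasure q (g -` B)"
      by (simp add: nn_integral_cmult nn_integral_multc)
    finally have "measure ?P ((f -` A) \<times> (g -` B)) = measure p (f -` A) * measure q (g -` B)"
      by (simp add: measure_def enn2real_mult)
    moreover have "(\<lambda>z. f (fst z)) -` A \<inter> (\<lambda>z. g (snd z)) -` B = (f -` A) \<times> (g -` B)" by auto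
    ultimately show ?thesis by simp
  qed
  have 2: "measure ?P ((\<lambda>z. f (fst z)) -` A) = measure p (f -` A)"
    "measure ?P ((\<lambda>z. g (snd z)) -` B) = measure q (g -` B)" for A B
    using 1[of A UNIV] 1[of UNIV B] by simp_all
  \<comment> \<open>Independence of two variables is that of a family over \<open>bool\<close>; in
    this form of the generating sets the criterion for two set systems applies.\<close>
  have case_bool_eq: "(\<lambda>i. {case_bool (\<lambda>z. f (fst z)) (\<lambda>z. g (snd z)) i -` A \<inter> space ?P |A.
         A \<in> sets (case_bool borel borel i)})
     = case_bool {(\<lambda>z. f (fst z)) -` A |A. A \<in> sets borel} {(\<lambda>z. g (snd z)) -` A |A. A \<in> sets borel}"
    by (auto simp: fun_eq_iff split: bool.split)
  show ?thesis
    unfolding prob_space.indep_var_def[OF measure_pmf.prob_space_axioms] prob_space.indep_vars_def2[OF measure_pmf.prob_space_axioms] case_bool_eq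
      prob_space.indep_set_def[OF measure_pmf.prob_space_axioms, symmetric] prob_space.indep_sets2_eq[OF measure_pmf.prob_space_axioms]
    by (auto simp: 1 2 split: bool.split)
qed

text \<open>The values lie in a general normed field because both real factors (second moments of
  sums) and complex ones (characteristic functions) occur later.\<close>

lemma
  fixes f :: "'a \<Rightarrow> 'c::{real_normed_field, banach, second_countable_topology}"
  assumes "integrable (measure_pmf p) f" "integrable (measure_pmf q) g"
  shows integrable_pair_pmf_mult: "integrable (measure_pmf (pair_pmf p q)) (\<lambda>z. f (fst z) * g (snd z))"
    and expectation_pair_pmf_mult: "measure_pmf.expectation (pair_pmf p q) (\<lambda>z. f (fst z) * g (snd z))
        = measure_pmf.expectation p f * measure_pmf.expectation q g"
proof -
  note iv = indep_var_pair_pmf[of p q f g]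
  have f: "integrable (measure_pmf (pair_pmf p q)) (\<lambda>z. f (fst z))"
    using assms(1) integrable_map_pmf_eq[where f=fst and p="pair_pmf p q" and g=f] by (simp add: map_fst_pair_pmf)
  have g: "integrable (measure_pmf (pair_pmf p q)) (\<lambda>z. g (snd z))"
    using assms(2) integrable_map_pmf_eq[where f=snd and p="pair_pmf p q" and g=g] by (simp add: map_snd_pair_pmf)
  show "integrable (measure_pmf (pair_pmf p q)) (\<lambda>z. f (fst z) * g (snd z))"
    using prob_space.indep_var_integrable[OF measure_pmf.prob_space_axioms iv f g] .
  show "measure_pmf.expectation (pair_pmf p q) (\<lambda>z. f (fst z) * g (snd z))
        = measure_pmf.expectation p f * measure_pmf.expectation q g"
    using prob_space.indep_var_lebesgue_integral[OF measure_pmf.prob_space_axioms iv f g] by simp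
qed

lemma replicate_pmf_Suc_pair:
  "replicate_pmf (Suc n) p = map_pmf (\<lambda>z. fst z # snd z) (pair_pmf p (replicate_pmf n p))"
  by (simp add: pair_pmf_def map_pmf_def bind_assoc_pmf bind_return_pmf)

lemma pmf_replicate_pmf:
  "pmf (replicate_pmf n p) xs = (if length xs = n then prod_list (map (pmf p) xs) else 0)"
proof (induction n arbitrary: xs)
  case 0
  show ?case by (cases xs) auto
next
  case (Suc n)
  have *: "pmf (map_pmf (\<lambda>z. fst z # snd z) (pair_pmf p (replicate_pmf n p))) (y # ys)
     = pmf p y * pmf (replicate_pmf n p) ys" for y ys
    using pmf_map_inj'[of "\<lambda>z. fst z # snd z" "pair_pmf p (replicate_pmf n p)" "(y, ys)"]
    by (simp add: inj_on_def pmf_pair prod_eq_iff)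
  show ?case
  proof (cases xs)
    case Nil
    have "[] \<notin> set_pmf (replicate_pmf (Suc n) p)" by (auto simp: set_replicate_pmf)
    then show ?thesis using Nil by (simp add: set_pmf_iff del: replicate_pmf.simps)
  next
    case (Cons y ys)
    then show ?thesis
      unfolding replicate_pmf_Suc_pair by (simp add: * Suc)
  qed
qed

lemma
  fixes f :: "'a \<Rightarrow> 'c::{real_normed_field, banach, second_countable_topology}"
  assumes "integrable (measure_pmf p) f"
  shows integrable_replicate_pmf_prod: "integrable (measure_pmf (replicate_pmf n p)) (\<lambda>xs. prod_list (map f xs))"
    and expectation_replicate_pmf_prod: "measure_pmf.expectation (replicate_pmf n p) (\<lambda>xs. prod_list (map f xs))
        = measure_pmf.expectation p f ^ n"
proof (induction n)
  case (Suc n)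
  { case 1
    show ?case unfolding replicate_pmf_Suc_pair
      using integrable_pair_pmf_mult[OF assms Suc(1)] by simp
  }
  { case 2
    show ?case unfolding replicate_pmf_Suc_pair
      using expectation_pair_pmf_mult[OF assms Suc(1)] Suc(2) by simp
  }
qed (auto intro!: integrable_measure_pmf_finite)

text \<open>All four facts share one induction: the second moment of the longer sum needs
  integrability of the shorter one and its zero mean, which removes the cross term.\<close>

lemma
  fixes f :: "'a \<Rightarrow> real"
  assumes f: "integrable (measure_pmf p) f" and f2: "integrable (measure_pmf p) (\<lambda>x. (f x)\<^sup>2)"
    and z: "measure_pmf.expectation p f = 0"
  shows integrable_replicate_pmf_sum: "integrable (measure_pmf (replicate_pmf n p)) (\<lambda>xs. sum_list (map f xs))"
    and integrable_replicate_pmf_sum_sq: "integrable (measure_pmf (replicate_pmf n p)) (\<lambda>xs. (sum_list (map f xs))\<^sup>2)"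
    and expectation_replicate_pmf_sum: "measure_pmf.expectation (replicate_pmf n p) (\<lambda>xs. sum_list (map f xs)) = 0"
    and expectation_replicate_pmf_sum_sq: "measure_pmf.expectation (replicate_pmf n p) (\<lambda>xs. (sum_list (map f xs))\<^sup>2)
        = n * measure_pmf.expectation p (\<lambda>x. (f x)\<^sup>2)"
proof (induction n)
  case (Suc n)
  let ?Q = "replicate_pmf n p" let ?P = "pair_pmf p ?Q"
  let ?s = "\<lambda>xs. sum_list (map f xs)"
  \<comment> \<open>With the constant 1 as the other factor, a function of one coordinate becomes an
    instance of the product rule.\<close>
  have one: "integrable (measure_pmf p) (\<lambda>_. 1::real)" "integrable (measure_pmf ?Q) (\<lambda>_. 1::real)" by auto
  note i1 = integrable_pair_pmf_mult[OF f one(2)] integrable_pair_pmf_mult[OF one(1) Suc(1)]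
    integrable_pair_pmf_mult[OF f2 one(2)] integrable_pair_pmf_mult[OF one(1) Suc(2)]
    integrable_pair_pmf_mult[OF f Suc(1)]
  note e1 = expectation_pair_pmf_mult[OF f one(2)] expectation_pair_pmf_mult[OF one(1) Suc(1)]
    expectation_pair_pmf_mult[OF f2 one(2)] expectation_pair_pmf_mult[OF one(1) Suc(2)]
    expectation_pair_pmf_mult[OF f Suc(1)]
  note i = i1[simplified] and e = e1[simplified]
  have sq: "(\<lambda>z. (f (fst z) + ?s (snd z))\<^sup>2) = (\<lambda>z. (f (fst z))\<^sup>2 + 2 * (f (fst z) * ?s (snd z)) + (?s (snd z))\<^sup>2)"
    by (auto simp: power2_eq_square algebra_simps)
  { case 1
    show ?case unfolding replicate_pmf_Suc_pair using i by simp }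
  { case 2
    show ?case unfolding replicate_pmf_Suc_pair using i by (simp add: sq) }
  { case 3
    show ?case unfolding replicate_pmf_Suc_pair using i e z Suc(3) by simp }
  { case 4
    have "measure_pmf.expectation ?P (\<lambda>z. (f (fst z) + ?s (snd z))\<^sup>2)
       = measure_pmf.expectation p (\<lambda>x. (f x)\<^sup>2) + n * measure_pmf.expectation p (\<lambda>x. (f x)\<^sup>2)"
      unfolding sq using i e z Suc(3,4) by simp
    then show ?case unfolding replicate_pmf_Suc_pair by (simp add: algebra_simps) }
qed (auto intro!: integrable_measure_pmf_finite)

lemma replicate_pmf_chebyshev:
  fixes f :: "'a \<Rightarrow> real"
  assumes f: "integrable (measure_pmf p) f" and f2: "integrable (measure_pmf p) (\<lambda>x. (f x)\<^sup>2)"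
    and "measure_pmf.expectation p f = 0" and "\<epsilon> > 0"
  shows "measure_pmf.prob (replicate_pmf n p) {xs. \<bar>sum_list (map f xs)\<bar> > \<epsilon>}
    \<le> n * measure_pmf.expectation p (\<lambda>x. (f x)\<^sup>2) / \<epsilon>\<^sup>2"
proof -
  let ?Q = "replicate_pmf n p" 
  have "measure_pmf.prob ?Q {xs. \<bar>sum_list (map f xs)\<bar> > \<epsilon>}
     \<le> measure_pmf.prob ?Q {xs\<in>space ?Q. (sum_list (map f xs))\<^sup>2 \<ge> \<epsilon>\<^sup>2}"
    using \<open>\<epsilon> > 0\<close> by (intro measure_pmf.finite_measure_mono) (auto simp: abs_le_square_iff[symmetric])
  also have "\<dots> \<le> measure_pmf.expectation ?Q (\<lambda>xs. (sum_list (map f xs))\<^sup>2) / \<epsilon>\<^sup>2"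
    using \<open>\<epsilon> > 0\<close> integrable_replicate_pmf_sum_sq[OF assms(1-3)]
    by (intro integral_Markov_inequality_measure[where A="{}"]) auto
  finally show ?thesis using expectation_replicate_pmf_sum_sq[OF assms(1-3)] by simp
qed

section \<open>Bessel functions and the law of an increment\<close>

text \<open>The Bessel-Clifford function. In the variable \<open>z = (x/2)^2\<close>,
  differentiation merely raises the index by one.\<close>

definition bessel_series :: "nat \<Rightarrow> real \<Rightarrow> real" where
  "bessel_series k z = (\<Sum>m. inverse (fact m * fact (k + m)) * z ^ m)"

lemma summable_bessel_series: "summable (\<lambda>m. inverse (fact m * fact (k + m)) * (z::real) ^ m)"
proof (rule summable_comparison_test')
  show "summable (\<lambda>m. inverse (fact m) * \<bar>z\<bar> ^ m)" by (rule summable_exp)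
  fix m :: nat assume "m \<ge> 0"
  have "inverse (fact m * fact (k + m)) \<le> (inverse (fact m) :: real)"
    by (intro le_imp_inverse_le) (auto simp: mult_le_cancel_left1 fact_ge_1)
  then show "norm (inverse (fact m * fact (k + m)) * z ^ m) \<le> inverse (fact m) * \<bar>z\<bar> ^ m"
    by (simp add: abs_mult power_abs mult_right_mono)
qed

lemma bessel_series_pos: "z \<ge> 0 \<Longrightarrow> bessel_series k z > 0"
  unfolding bessel_series_def
  by (rule suminf_pos2[OF summable_bessel_series, where i=0]) auto

lemma bessel_series_Suc_le: "z \<ge> 0 \<Longrightarrow> bessel_series (Suc k) z \<le> bessel_series k z"
  unfolding bessel_series_def
  by (intro suminf_le summable_bessel_series mult_right_mono le_imp_inverse_le mult_left_mono fact_mono) auto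

lemma has_derivative_bessel_series:
  "(bessel_series k has_real_derivative bessel_series (Suc k) z) (at z)"
proof -
  have "diffs (\<lambda>m. inverse (fact m * fact (k + m))) = (\<lambda>m. inverse (fact m * fact (Suc k + m)) :: real)"
    by (auto simp: diffs_def fun_eq_iff field_simps simp del: fact_Suc) (simp add: field_simps)
  then show ?thesis
    using termdiffs_strong_converges_everywhere[OF summable_bessel_series, of k z]
    by (simp add: bessel_series_def[abs_def])
qed

lemma bessel_series_mono:
  assumes "0 \<le> z" "z \<le> w" shows "bessel_series k z \<le> bessel_series k w"
proof (rule DERIV_nonneg_imp_nondecreasing[OF assms(2)])
  fix x assume "z \<le> x" "x \<le> w"
  then show "\<exists>y. (bessel_series k has_real_derivative y) (at x) \<and> 0 \<le> y"
    using has_derivative_bessel_series[of k x] bessel_series_pos[of x "Suc k"] assms by force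
qed

text \<open>A Gronwall argument: the derivative never exceeds the function, so multiplication by
  \<open>exp (-z)\<close> makes it nonincreasing.\<close>

lemma bessel_series_growth:
  assumes "0 \<le> z" "z \<le> w" shows "bessel_series k w \<le> exp (w - z) * bessel_series k z"
proof -
  have "exp (-w) * bessel_series k w \<le> exp (-z) * bessel_series k z"
  proof (rule DERIV_nonpos_imp_nonincreasing[OF assms(2)])
    fix x assume "z \<le> x" "x \<le> w"
    then have "bessel_series (Suc k) x \<le> bessel_series k x"
      using assms by (intro bessel_series_Suc_le) auto
    moreover have "((\<lambda>x. exp (-x) * bessel_series k x) has_real_derivative
        exp (-x) * (bessel_series (Suc k) x - bessel_series k x)) (at x)"
      by (auto intro!: derivative_eq_intros has_derivative_bessel_series simp: algebra_simps)
    ultimately show "\<exists>y. ((\<lambda>x. exp (-x) * bessel_series k x) has_real_derivative y) (at x) \<and> y \<le> 0"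
      by (meson diff_le_0_iff_le exp_ge_zero mult_nonneg_nonpos)
  qed
  then have "exp w * (exp (-w) * bessel_series k w) \<le> exp w * (exp (-z) * bessel_series k z)"
    by (intro mult_left_mono) auto
  then show ?thesis by (simp add: mult.assoc[symmetric] exp_add[symmetric])
qed

text \<open>The Lipschitz constant 1 does not depend on \<open>k\<close>; this makes the error in
  the log-likelihood uniform over all sizes of the increment.\<close>

lemma abs_ln_bessel_series_diff_le:
  assumes "0 \<le> z" "0 \<le> w"
  shows "\<bar>ln (bessel_series k w / bessel_series k z)\<bar> \<le> \<bar>w - z\<bar>"
proof -
  have *: "\<bar>ln (bessel_series k w / bessel_series k z)\<bar> \<le> w - z" if "0 \<le> z" "z \<le> w" for z w
  proof -
    have "ln (bessel_series k w / bessel_series k z) \<ge> 0"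
      using bessel_series_mono[OF that] bessel_series_pos[of z k] that by simp
    moreover have "bessel_series k w / bessel_series k z \<le> exp (w - z)"
      using bessel_series_growth[OF that] bessel_series_pos[of z k] that by (simp add: field_simps)
    then have "ln (bessel_series k w / bessel_series k z) \<le> ln (exp (w - z))"
      using bessel_series_pos[of z k] bessel_series_pos[of w k] that by (intro ln_mono) auto
    ultimately show ?thesis by simp
  qed
  show ?thesis
  proof (cases "z \<le> w")
    case False
    then have "\<bar>ln (bessel_series k z / bessel_series k w)\<bar> \<le> z - w" using assms by (intro *) auto
    then show ?thesis using False assms bessel_series_pos[of z k] bessel_series_pos[of w k]
      by (simp add: ln_div abs_minus_commute)
  qed (use * assms in auto)
qed

lemma besselI_eq_bessel_series: "besselI k x = (x/2) ^ k * bessel_series k ((x/2)\<^sup>2)"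
proof -
  have "(x/2) ^ (2*m + k) / (fact m * Gamma (real k + real m + 1))
     = (x/2) ^ k * (inverse (fact m * fact (k + m)) * ((x/2)\<^sup>2) ^ m)" for m
    using Gamma_fact[of "k + m", where 'a=real]
    by (simp add: power_add power_mult add.commute add.left_commute divide_simps)
  then show ?thesis
    unfolding besselI_def bessel_series_def by (simp only: suminf_mult[OF summable_bessel_series])
qed

lemma besselI_pos: "x > 0 \<Longrightarrow> besselI k x > 0"
  by (simp add: besselI_eq_bessel_series bessel_series_pos)

text \<open>The quotient of the Bessel functions is one factor \<open>x/2\<close> times a quotient
  of neighbouring series, which is at most 1. Inside \<open>phi\<close> this makes
  \<open>h_fun\<close> a bounded perturbation.\<close>

lemma h_fun_bounds:
  assumes "\<theta> * \<Delta> > 0"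
  shows "0 \<le> h_fun \<Delta> \<theta> k" "h_fun \<Delta> \<theta> k \<le> \<theta> * \<Delta> / 2"
proof -
  let ?x = "\<theta> * \<Delta>" and ?k = "nat \<bar>k\<bar>"
  show "0 \<le> h_fun \<Delta> \<theta> k"
    using assms unfolding h_fun_def by (intro divide_nonneg_nonneg less_imp_le[OF besselI_pos])
  have "besselI (?k + 1) ?x \<le> ?x / 2 * besselI ?k ?x"
  proof -
    have "0 \<le> (?x/2) ^ (?k + 1)" using assms by (intro zero_le_power) simp
    then have "(?x/2) ^ (?k + 1) * bessel_series (Suc ?k) ((?x/2)\<^sup>2) \<le> (?x/2) ^ (?k + 1) * bessel_series ?k ((?x/2)\<^sup>2)"
      by (intro mult_left_mono bessel_series_Suc_le) auto
    then show ?thesis unfolding besselI_eq_bessel_series by (simp add: mult.assoc)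
  qed
  then show "h_fun \<Delta> \<theta> k \<le> \<theta> * \<Delta> / 2"
    using assms besselI_pos[of ?x ?k] unfolding h_fun_def by (simp add: divide_le_eq)
qed

text \<open>Two errors of size \<open>\<bar>\<theta>' - \<theta>\<bar> * \<Delta>\<close> add up,
  one from the exponential prefactor and one from the series. The argument of the series moves by
  \<open>(?y - ?x) * ((\<theta> + \<theta>') * \<Delta> / 4)\<close>, whence the bound 4 in the
  hypothesis.\<close>

lemma abs_ln_f_incr_ratio_le:
  assumes "\<theta> > 0" "\<theta>' > 0" "\<Delta> > 0" "(\<theta> + \<theta>') * \<Delta> \<le> 4"
  shows "\<bar>ln (f_incr \<Delta> \<theta>' k / f_incr \<Delta> \<theta> k) - \<bar>real_of_int k\<bar> * ln (\<theta>' / \<theta>)\<bar> \<le> 2 * \<bar>\<theta>' - \<theta>\<bar> * \<Delta>"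
proof -
  let ?x = "\<theta> * \<Delta>" and ?y = "\<theta>' * \<Delta>" and ?k = "nat \<bar>k\<bar>"
  let ?G = "\<lambda>x. bessel_series ?k ((x/2)\<^sup>2)"
  have G: "?G ?x > 0" "?G ?y > 0" by (auto intro: bessel_series_pos)
  have "f_incr \<Delta> \<theta>' k / f_incr \<Delta> \<theta> k = exp (?x - ?y) * (\<theta>'/\<theta>) ^ ?k * (?G ?y / ?G ?x)"
    using assms G unfolding f_incr_def besselI_eq_bessel_series
    by (simp add: exp_diff exp_minus power_divide power_mult_distrib field_simps)
  then have "ln (f_incr \<Delta> \<theta>' k / f_incr \<Delta> \<theta> k) = ?x - ?y + ?k * ln (\<theta>'/\<theta>) + ln (?G ?y / ?G ?x)"
    using assms G by (simp add: ln_mult_pos ln_realpow del: times_divide_eq_right)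
  then have "\<bar>ln (f_incr \<Delta> \<theta>' k / f_incr \<Delta> \<theta> k) - \<bar>real_of_int k\<bar> * ln (\<theta>' / \<theta>)\<bar>
      \<le> \<bar>?x - ?y\<bar> + \<bar>(?y/2)\<^sup>2 - (?x/2)\<^sup>2\<bar>"
    using abs_ln_bessel_series_diff_le[of "(?x/2)\<^sup>2" "(?y/2)\<^sup>2" ?k] by simp (simp only: abs_le_iff, linarith)
  also have "(?y/2)\<^sup>2 - (?x/2)\<^sup>2 = (?y - ?x) * ((\<theta> + \<theta>') * \<Delta> / 4)"
    by (simp add: power2_eq_square field_simps)
  also have "\<bar>?x - ?y\<bar> + \<bar>(?y - ?x) * ((\<theta> + \<theta>') * \<Delta> / 4)\<bar> \<le> \<bar>?y - ?x\<bar> + \<bar>?y - ?x\<bar> * 1"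
    using assms by (intro add_mono) (auto simp: abs_mult intro!: mult_left_mono)
  also have "\<dots> = 2 * \<bar>\<theta>' - \<theta>\<bar> * \<Delta>"
    using assms by (simp add: abs_mult flip: left_diff_distrib)
  finally show ?thesis .
qed

section \<open>The random walk and the compound Poisson law of an increment\<close>

definition walk_pmf :: "nat \<Rightarrow> int pmf" where
  "walk_pmf n = map_pmf sum_list (replicate_pmf n rademacher_pmf)"

lemma rademacher_pmf_eq: "rademacher_pmf = map_pmf (\<lambda>b. if b then 1 else -1) (bernoulli_pmf (1/2))"
  unfolding rademacher_pmf_def bernoulli_pmf_half_conv_pmf_of_set
  by (subst map_pmf_of_set_inj) (auto simp: inj_on_def UNIV_bool insert_commute)

lemma replicate_map_pmf: "replicate_pmf n (map_pmf f p) = map_pmf (map f) (replicate_pmf n p)"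
  by (induction n) (simp_all add: map_pmf_def bind_assoc_pmf bind_return_pmf)

lemma walk_pmf_binomial: "walk_pmf n = map_pmf (\<lambda>j. 2 * int j - int n) (binomial_pmf n (1/2))"
proof -
  have "sum_list (map (\<lambda>b. if b then 1 else -1) bs) = 2 * int (length (filter id bs)) - int (length bs)" for bs
    by (induction bs) auto
  then show ?thesis
    unfolding walk_pmf_def rademacher_pmf_eq replicate_map_pmf
    by (auto simp: binomial_pmf_altdef pmf.map_comp set_replicate_pmf intro!: map_pmf_cong)
qed

lemma pmf_walk_pmf_even: "pmf (walk_pmf (nat \<bar>k\<bar> + 2 * m)) k = real (nat \<bar>k\<bar> + 2 * m choose m) / 2 ^ (nat \<bar>k\<bar> + 2 * m)"
proof -
  let ?n = "nat \<bar>k\<bar> + 2 * m"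
  have inj: "inj (\<lambda>j. 2 * int j - int ?n)" by (auto simp: inj_on_def)
  \<comment> \<open>\<open>j\<close> counts the upward steps; there are \<open>m\<close> steps in
    the direction opposite to \<open>k\<close>. The two cases give the same binomial coefficient by
    symmetry.\<close>
  define j where "j = (if k \<ge> 0 then nat k + m else m)"
  have "k = 2 * int j - int ?n" by (auto simp: j_def)
  then have "pmf (walk_pmf ?n) k = pmf (binomial_pmf ?n (1/2)) j"
    unfolding walk_pmf_binomial using pmf_map_inj'[OF inj] by metis
  also have "\<dots> = real (?n choose j) / 2 ^ ?n"
  proof -
    have "j \<le> ?n" by (auto simp: j_def)
    then show ?thesis by (simp add: power_one_over mult.assoc flip: power_add)
  qed
  also have "?n choose j = ?n choose m"
    using binomial_symmetric[of m ?n] by (auto simp: j_def add.commute)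
  finally show ?thesis .
qed

lemma pmf_walk_pmf_zero:
  assumes "n \<notin> range (\<lambda>m. nat \<bar>k\<bar> + 2 * m)" shows "pmf (walk_pmf n) k = 0"
proof -
  have "k \<notin> set_pmf (walk_pmf n)"
  proof
    assume "k \<in> set_pmf (walk_pmf n)"
    then obtain j where j: "j \<le> n" "k = 2 * int j - int n"
      unfolding walk_pmf_binomial by (auto simp: set_pmf_binomial_eq)
    have "n = nat \<bar>k\<bar> + 2 * (if k \<ge> 0 then n - j else j)" using j by auto
    then show False using assms by blast
  qed
  then show ?thesis by (simp add: set_pmf_iff)
qed

lemma incr_pmf_altdef: "incr_pmf \<theta> \<Delta> = bind_pmf (poisson_pmf (\<theta> * \<Delta>)) walk_pmf"
  unfolding incr_pmf_def walk_pmf_def ..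

text \<open>Condition on the number of jumps. Only \<open>\<bar>k\<bar> + 2 * m\<close> jumps can
  lead to \<open>k\<close>; there the factorial of the Poisson weight cancels against the binomial
  coefficient, which leaves \<open>fact m * fact (\<bar>k\<bar> + m)\<close> and a factor 1/2 per
  jump, that is, the Bessel series.\<close>

lemma pmf_incr_pmf:
  assumes "\<theta> * \<Delta> > 0" shows "pmf (incr_pmf \<theta> \<Delta>) k = f_incr \<Delta> \<theta> k"
proof -
  let ?x = "\<theta> * \<Delta>"
  let ?t = "\<lambda>n. pmf (poisson_pmf ?x) n * pmf (walk_pmf n) k"
  have "ennreal (pmf (incr_pmf \<theta> \<Delta>) k) = (\<Sum>n. ennreal (?t n))"
    unfolding incr_pmf_altdef
    by (simp add: ennreal_pmf_bind nn_integral_measure_pmf nn_integral_count_space_nat ennreal_mult')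
  then have "(\<lambda>n. ennreal (?t n)) sums ennreal (pmf (incr_pmf \<theta> \<Delta>) k)"
    by (simp add: summable_sums)
  then have "?t sums pmf (incr_pmf \<theta> \<Delta>) k"
    by (subst (asm) sums_ennreal) auto
  then have "(\<lambda>m. ?t (nat \<bar>k\<bar> + 2 * m)) sums pmf (incr_pmf \<theta> \<Delta>) k"
    by (subst sums_mono_reindex) (auto simp: strict_mono_def pmf_walk_pmf_zero)
  moreover have "?t (nat \<bar>k\<bar> + 2 * m) = exp (-?x) * ((?x/2) ^ (2*m + nat \<bar>k\<bar>) / (fact m * fact (nat \<bar>k\<bar> + m)))" for m
  proof -
    have n: "nat \<bar>k\<bar> + 2 * m - m = nat \<bar>k\<bar> + m" by simp
    show ?thesis
      using assms unfolding pmf_walk_pmf_even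
      by (simp add: binomial_fact[where 'a=real] n power_divide add.commute mult_ac del: of_nat_add)
  qed
  moreover have "Gamma (real (nat \<bar>k\<bar>) + real m + 1) = fact (nat \<bar>k\<bar> + m)" for m
    using Gamma_fact[of "nat \<bar>k\<bar> + m", where 'a=real] by (simp add: add.commute add.left_commute)
  moreover have "summable (\<lambda>m. (?x/2) ^ (2*m + nat \<bar>k\<bar>) / (fact m * fact (nat \<bar>k\<bar> + m)))"
    using summable_mult[OF summable_bessel_series[of "nat \<bar>k\<bar>" "(?x/2)\<^sup>2"], of "(?x/2)^ nat \<bar>k\<bar>"]
    by (rule back_subst[where P=summable]) (simp add: fun_eq_iff divide_simps power_add power_mult)
  ultimately show ?thesis
    unfolding f_incr_def besselI_def by (simp add: sums_iff suminf_mult del: times_divide_eq_right)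
qed

section \<open>Moments of an increment\<close>

text \<open>The one-step recursion serves two functions: \<open>k^2\<close>, which a step raises by
  1 on average, and \<open>cosh (s * k)\<close>, an eigenfunction with eigenvalue
  \<open>cosh s\<close>.\<close>

lemma nn_integral_walk_pmf_Suc:
  "(\<integral>\<^sup>+k. f k \<partial>walk_pmf (Suc n)) = (\<integral>\<^sup>+k. (f (k + 1) + f (k - 1)) / 2 \<partial>walk_pmf n)"
proof -
  have "(\<integral>\<^sup>+k. f k \<partial>walk_pmf (Suc n)) = (\<integral>\<^sup>+e. \<integral>\<^sup>+k. f (e + k) \<partial>walk_pmf n \<partial>rademacher_pmf)"
    by (simp add: walk_pmf_def map_bind_pmf)
  also have "\<dots> = ((\<integral>\<^sup>+k. f (k - 1) \<partial>walk_pmf n) + (\<integral>\<^sup>+k. f (k + 1) \<partial>walk_pmf n)) / 2"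
    unfolding rademacher_pmf_def by (subst nn_integral_pmf_of_set) (auto simp: add.commute)
  also have "\<dots> = (\<integral>\<^sup>+k. (f (k + 1) + f (k - 1)) / 2 \<partial>walk_pmf n)"
    by (simp add: nn_integral_divide nn_integral_add add.commute)
  finally show ?thesis .
qed

lemma nn_integral_walk_pmf_square: "(\<integral>\<^sup>+k. ennreal ((real_of_int k)\<^sup>2) \<partial>walk_pmf n) = ennreal n"
proof (induction n)
  case 0
  show ?case by (simp add: walk_pmf_def)
next
  case (Suc n)
  have "(ennreal ((real_of_int (k + 1))\<^sup>2) + ennreal ((real_of_int (k - 1))\<^sup>2)) / 2 = ennreal ((real_of_int k)\<^sup>2) + 1" for k
  proof -
    have "(ennreal ((real_of_int (k + 1))\<^sup>2) + ennreal ((real_of_int (k - 1))\<^sup>2)) / 2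
       = ennreal (((real_of_int (k + 1))\<^sup>2 + (real_of_int (k - 1))\<^sup>2) / 2)"
      by (simp add: divide_ennreal[symmetric] ennreal_plus)
    also have "((real_of_int (k + 1))\<^sup>2 + (real_of_int (k - 1))\<^sup>2) / 2 = (real_of_int k)\<^sup>2 + 1"
      by (simp add: power2_eq_square field_simps)
    finally show ?thesis by simp
  qed
  then show ?case
    by (simp add: nn_integral_walk_pmf_Suc nn_integral_add Suc add.commute ennreal_plus)
qed

text \<open>Being even, \<open>cosh\<close> can control \<open>exp \<bar>k\<bar>\<close>, and the
  symmetry of the steps keeps its mean explicit.\<close>

lemma nn_integral_walk_pmf_cosh: "(\<integral>\<^sup>+k. ennreal (cosh (s * real_of_int k)) \<partial>walk_pmf n) = ennreal (cosh s ^ n)"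
proof (induction n)
  case 0
  show ?case by (simp add: walk_pmf_def)
next
  case (Suc n)
  have "(ennreal (cosh (s * real_of_int (k + 1))) + ennreal (cosh (s * real_of_int (k - 1)))) / 2
      = ennreal (cosh s) * ennreal (cosh (s * real_of_int k))" for k
  proof -
    have "(ennreal (cosh (s * real_of_int (k + 1))) + ennreal (cosh (s * real_of_int (k - 1)))) / 2
       = ennreal ((cosh (s * real_of_int (k + 1)) + cosh (s * real_of_int (k - 1))) / 2)"
      by (simp add: divide_ennreal[symmetric] ennreal_plus)
    also have "(cosh (s * real_of_int (k + 1)) + cosh (s * real_of_int (k - 1))) / 2 = cosh s * cosh (s * real_of_int k)"
      by (simp add: algebra_simps cosh_add cosh_diff)
    finally show ?thesis by (simp add: ennreal_mult)
  qed
  then show ?case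
    by (simp add: nn_integral_walk_pmf_Suc nn_integral_cmult Suc ennreal_mult)
qed

lemma nn_integral_poisson_pmf:
  assumes "x > 0" "\<And>n. f n \<ge> 0" "(\<lambda>n. x ^ n / fact n * f n) sums s"
  shows "(\<integral>\<^sup>+n. ennreal (f n) \<partial>poisson_pmf x) = ennreal (exp (-x) * s)"
proof -
  have "(\<integral>\<^sup>+n. ennreal (f n) \<partial>poisson_pmf x) = (\<Sum>n. ennreal (exp (-x) * (x ^ n / fact n * f n)))"
    using assms(1,2)
    by (simp add: nn_integral_measure_pmf nn_integral_count_space_nat ennreal_mult'[symmetric] mult_ac)
  also have "\<dots> = ennreal (exp (-x) * s)"
  proof -
    have "0 \<le> s" using assms(1,2) by (intro sums_le[OF _ sums_zero assms(3)]) simp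
    then have "(\<lambda>n. ennreal (exp (-x) * (x ^ n / fact n * f n))) sums ennreal (exp (-x) * s)"
      using assms(1,2) sums_mult[OF assms(3), of "exp (-x)"] by (intro iffD2[OF sums_ennreal]) simp_all
    then show ?thesis by (rule sums_unique[symmetric])
  qed
  finally show ?thesis .
qed

lemma
  assumes "\<theta> * \<Delta> > 0"
  shows integrable_incr_pmf_square: "integrable (incr_pmf \<theta> \<Delta>) (\<lambda>k. (real_of_int k)\<^sup>2)"
    and expectation_incr_pmf_square: "measure_pmf.expectation (incr_pmf \<theta> \<Delta>) (\<lambda>k. (real_of_int k)\<^sup>2) = \<theta> * \<Delta>"
proof -
  let ?x = "\<theta> * \<Delta>"
  have "(\<lambda>n. inverse (fact n) * ?x ^ n) sums exp ?x" using exp_converges[of ?x] by (simp add: mult.commute)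
  \<comment> \<open>The walk of \<open>n\<close> steps has second moment \<open>n\<close>, so the
    Poisson mean is wanted. Its series is the exponential series shifted by one index, with a
    vanishing term at 0.\<close>
  then have "(\<lambda>n. ?x * (inverse (fact n) * ?x ^ n)) sums (?x * exp ?x)" by (rule sums_mult)
  moreover have "?x * (inverse (fact n) * ?x ^ n) = ?x ^ Suc n / fact (Suc n) * real (Suc n)" for n
    by (simp add: divide_simps del: of_nat_Suc)
  ultimately have "(\<lambda>n. ?x ^ Suc n / fact (Suc n) * real (Suc n)) sums (?x * exp ?x)"
    by simp
  then have "(\<lambda>n. ?x ^ n / fact n * real n) sums (?x * exp ?x)"
    by (subst (asm) sums_Suc_iff) simp
  then have "(\<integral>\<^sup>+k. ennreal ((real_of_int k)\<^sup>2) \<partial>incr_pmf \<theta> \<Delta>) = ennreal ?x"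
    using assms nn_integral_poisson_pmf[of ?x real "?x * exp ?x"]
    by (simp add: incr_pmf_altdef nn_integral_walk_pmf_square exp_minus)
  then have "has_bochner_integral (incr_pmf \<theta> \<Delta>) (\<lambda>k. (real_of_int k)\<^sup>2) ?x"
    using assms by (intro has_bochner_integral_nn_integral) auto
  then show "integrable (incr_pmf \<theta> \<Delta>) (\<lambda>k. (real_of_int k)\<^sup>2)"
    "measure_pmf.expectation (incr_pmf \<theta> \<Delta>) (\<lambda>k. (real_of_int k)\<^sup>2) = ?x"
    by (auto simp: has_bochner_integral_iff)
qed

lemma
  assumes "\<theta> * \<Delta> > 0"
  shows integrable_incr_pmf_cosh: "integrable (incr_pmf \<theta> \<Delta>) (\<lambda>k. cosh (s * real_of_int k))"
    and expectation_incr_pmf_cosh: "measure_pmf.expectation (incr_pmf \<theta> \<Delta>) (\<lambda>k. cosh (s * real_of_int k))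
       = exp (\<theta> * \<Delta> * (cosh s - 1))"
proof -
  let ?x = "\<theta> * \<Delta>"
  have "(\<lambda>n. ?x ^ n / fact n * cosh s ^ n) sums exp (?x * cosh s)"
    using exp_converges[of "?x * cosh s"] by (simp add: field_simps power_mult_distrib)
  then have "(\<integral>\<^sup>+k. ennreal (cosh (s * real_of_int k)) \<partial>incr_pmf \<theta> \<Delta>) = ennreal (exp (?x * (cosh s - 1)))"
    using assms nn_integral_poisson_pmf[of ?x "\<lambda>n. cosh s ^ n" "exp (?x * cosh s)"]
    by (simp add: incr_pmf_altdef nn_integral_walk_pmf_cosh exp_add[symmetric] algebra_simps)
  then have "has_bochner_integral (incr_pmf \<theta> \<Delta>) (\<lambda>k. cosh (s * real_of_int k)) (exp (?x * (cosh s - 1)))"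
    by (intro has_bochner_integral_nn_integral) auto
  then show "integrable (incr_pmf \<theta> \<Delta>) (\<lambda>k. cosh (s * real_of_int k))"
    "measure_pmf.expectation (incr_pmf \<theta> \<Delta>) (\<lambda>k. cosh (s * real_of_int k)) = exp (?x * (cosh s - 1))"
    by (auto simp: has_bochner_integral_iff)
qed

text \<open>The 108 is that of \<open>cube_exp_le_cosh\<close>; the rest comes from
  \<open>exp (x * c) - 1 \<le> x * c * exp c\<close> for \<open>0 \<le> x \<le> 1\<close>, with
  \<open>c = cosh 2 - 1\<close>.\<close>

definition cube_exp_const :: real where
  "cube_exp_const = 108 * (cosh 2 - 1) * exp (cosh 2 - 1)"

lemma cube_exp_const_nonneg: "cube_exp_const \<ge> 0"
  using cosh_real_ge_1[of 2] by (simp add: cube_exp_const_def)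

text \<open>Subtracting 1 makes the mean of the right side of order
  \<open>\<theta> * \<Delta>\<close> instead of order one. It is affordable because \<open>k\<close>
  is an integer: away from 0, \<open>\<bar>k\<bar> \<ge> 1\<close> keeps \<open>cosh\<close> well
  above 1.\<close>

lemma cube_exp_le_cosh: "\<bar>real_of_int k\<bar> ^ 3 * exp \<bar>real_of_int k\<bar> \<le> 108 * (cosh (2 * real_of_int k) - 1)"
proof (cases "k = 0")
  case False
  define y where "y = \<bar>real_of_int k\<bar>"
  define e where "e = exp y ^ 2"
  have y: "y \<ge> 1" using False by (simp add: y_def)
  \<comment> \<open>Cubing \<open>y / 3 \<le> exp (y / 3)\<close> costs the factor 27. Absorbing the
    subtracted 1, possible since \<open>e \<ge> 4\<close>, costs a further 4, which gives
    108.\<close>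
  have "(y / 3) ^ 3 \<le> exp (y / 3) ^ 3"
    using y exp_ge_add_one_self[of "y/3"] by (intro power_mono) (simp_all del: exp_ge_add_one_self)
  then have "y ^ 3 \<le> 27 * exp y"
    by (simp add: power_divide exp_of_nat_mult[symmetric])
  then have 1: "y ^ 3 * exp y \<le> 27 * e"
    using mult_right_mono[of "y ^ 3" "27 * exp y" "exp y"] by (simp add: e_def power2_eq_square)
  have "2 ^ 2 \<le> e"
    unfolding e_def using y exp_ge_add_one_self[of y] by (intro power_mono) linarith+
  then have "e / 4 \<le> (e + i) / 2 - 1" if "i > 0" for i using that by (simp add: field_simps)
  then have "e / 4 \<le> (e + inverse e) / 2 - 1" by (simp add: e_def)
  moreover have "cosh (2 * real_of_int k) = (e + inverse e) / 2"
  proof -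
    have "cosh (2 * real_of_int k) = cosh (2 * y)" by (simp add: y_def abs_if)
    also have "\<dots> = (e + inverse e) / 2"
      by (simp add: cosh_field_def e_def exp_minus exp_double)
    finally show ?thesis .
  qed
  ultimately have "e / 4 \<le> cosh (2 * real_of_int k) - 1" by (simp only:)
  then have "27 * e \<le> 108 * (cosh (2 * real_of_int k) - 1)" by simp
  with 1 show ?thesis unfolding y_def[symmetric] by (rule order_trans)
qed simp

lemma
  assumes "\<theta> * \<Delta> > 0"
  shows integrable_incr_pmf_cube_exp: "integrable (incr_pmf \<theta> \<Delta>) (\<lambda>k. \<bar>real_of_int k\<bar> ^ 3 * exp \<bar>real_of_int k\<bar>)"
    and expectation_incr_pmf_cube_exp_le: "\<theta> * \<Delta> \<le> 1 \<Longrightarrow>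
      measure_pmf.expectation (incr_pmf \<theta> \<Delta>) (\<lambda>k. \<bar>real_of_int k\<bar> ^ 3 * exp \<bar>real_of_int k\<bar>)
       \<le> cube_exp_const * (\<theta> * \<Delta>)"
proof -
  let ?x = "\<theta> * \<Delta>" and ?P = "incr_pmf \<theta> \<Delta>" and ?c = "cosh 2 - 1 :: real"
  note ic = integrable_incr_pmf_cosh[OF assms, of 2]
  have i2: "integrable ?P (\<lambda>k. 108 * (cosh (2 * real_of_int k) - 1))" using ic by simp
  show i: "integrable ?P (\<lambda>k. \<bar>real_of_int k\<bar> ^ 3 * exp \<bar>real_of_int k\<bar>)"
    by (rule Bochner_Integration.integrable_bound[OF i2])
       (use cube_exp_le_cosh cosh_real_ge_1 in \<open>auto simp: abs_mult power_abs\<close>)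
  assume x: "?x \<le> 1"
  have "measure_pmf.expectation ?P (\<lambda>k. \<bar>real_of_int k\<bar> ^ 3 * exp \<bar>real_of_int k\<bar>)
      \<le> measure_pmf.expectation ?P (\<lambda>k. 108 * (cosh (2 * real_of_int k) - 1))"
    by (intro integral_mono i i2 cube_exp_le_cosh)
  also have "\<dots> = 108 * (exp (?x * ?c) - 1)"
    using ic expectation_incr_pmf_cosh[OF assms, of 2] by simp
  also have "exp (?x * ?c) - 1 \<le> ?x * ?c * exp (?x * ?c)"
  proof -
    have "(1 - ?x * ?c) * exp (?x * ?c) \<le> exp (- (?x * ?c)) * exp (?x * ?c)"
      using exp_ge_add_one_self[of "-(?x * ?c)"] by (intro mult_right_mono) (simp_all del: exp_ge_add_one_self)
    also have "\<dots> = 1" by (simp flip: exp_add)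
    finally show ?thesis by (simp add: left_diff_distrib)
  qed
  also have "\<dots> \<le> ?x * ?c * exp ?c"
    using assms x cosh_real_ge_1[of 2] mult_right_mono[of ?x 1 ?c] by (intro mult_left_mono) auto
  finally show "measure_pmf.expectation ?P (\<lambda>k. \<bar>real_of_int k\<bar> ^ 3 * exp \<bar>real_of_int k\<bar>) \<le> cube_exp_const * ?x"
    by (simp add: cube_exp_const_def algebra_simps)
qed

section \<open>A single increment under a local shift of the parameter\<close>

text \<open>Integers satisfy \<open>\<bar>k\<bar> \<le> k^2\<close>. Thus the mean of
  \<open>\<bar>X\<bar>\<close> is of order \<open>\<Delta>\<close> like the second moment, and
  centring changes the variance only at order \<open>\<Delta>^2\<close>.\<close>

lemma
  assumes "\<theta> * \<Delta> > 0"
  shows integrable_incr_pmf_abs: "integrable (incr_pmf \<theta> \<Delta>) (\<lambda>k. \<bar>real_of_int k\<bar>)"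
    and expectation_incr_pmf_abs_le: "measure_pmf.expectation (incr_pmf \<theta> \<Delta>) (\<lambda>k. \<bar>real_of_int k\<bar>) \<le> \<theta> * \<Delta>"
proof -
  have le: "\<bar>real_of_int k\<bar> \<le> (real_of_int k)\<^sup>2" for k
  proof -
    have "\<bar>k\<bar> \<le> k\<^sup>2" using self_le_power[of "\<bar>k\<bar>" 2] by (cases "k = 0") auto
    then have "real_of_int \<bar>k\<bar> \<le> real_of_int (k\<^sup>2)" by (simp only: of_int_le_iff)
    then show ?thesis by simp
  qed
  show i: "integrable (incr_pmf \<theta> \<Delta>) (\<lambda>k. \<bar>real_of_int k\<bar>)"
    by (rule Bochner_Integration.integrable_bound[OF integrable_incr_pmf_square[OF assms]]) (use le in auto)
  have "measure_pmf.expectation (incr_pmf \<theta> \<Delta>) (\<lambda>k. \<bar>real_of_int k\<bar>)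
     \<le> measure_pmf.expectation (incr_pmf \<theta> \<Delta>) (\<lambda>k. (real_of_int k)\<^sup>2)"
    by (intro integral_mono i integrable_incr_pmf_square assms le)
  then show "measure_pmf.expectation (incr_pmf \<theta> \<Delta>) (\<lambda>k. \<bar>real_of_int k\<bar>) \<le> \<theta> * \<Delta>"
    using expectation_incr_pmf_square[OF assms] by simp
qed

section \<open>The limit of the normalised Fisher information\<close>

lemma abs_phi_le:
  assumes "\<theta> > 0" "d > 0"
  shows "\<bar>d * phi \<theta> d - 1 / \<theta>\<bar> \<le> d * (1 + \<theta> * d)\<^sup>2 + 2 * d * (1 + \<theta> * d)"
proof -
  let ?x = "\<theta> * d" and ?P = "incr_pmf \<theta> d"
  let ?w = "\<lambda>k. h_fun d \<theta> k - 1" and ?Y = "\<lambda>k. \<bar>real_of_int k\<bar>"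
  define B where "B = 1 + ?x"
  have x: "?x > 0" using assms by simp
  have w: "\<bar>?w k\<bar> \<le> B" for k
    using h_fun_bounds[OF x, of k] x unfolding B_def by (simp add: abs_le_iff)
  have w2: "(?w k)\<^sup>2 \<le> B\<^sup>2" for k
    using power_mono[OF w[of k], of 2] by simp
  note iY = integrable_incr_pmf_abs[OF x] and iY2 = integrable_incr_pmf_square[OF x]
  have iw2: "integrable ?P (\<lambda>k. (?w k)\<^sup>2)"
    by (rule measure_pmf.integrable_const_bound[where B="B\<^sup>2"]) (use w2 in auto)
  have iwY: "integrable ?P (\<lambda>k. ?w k * ?Y k)"
    by (rule Bochner_Integration.integrable_bound[of _ "\<lambda>k. B * ?Y k"])
       (use iY in \<open>auto simp: abs_mult intro!: mult_right_mono order.trans[OF w abs_ge_self]\<close>)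
  \<comment> \<open>The last summand alone produces the limit: \<open>d\<close> times its mean is
    exactly \<open>1 / \<theta>\<close>. The other two contribute order \<open>d\<close>, since
    \<open>?w\<close> is bounded and the mean of \<open>?Y\<close> is at most
    \<open>?x\<close>.\<close>
  have eq: "(h_fun d \<theta> k + ?Y k / ?x - 1)\<^sup>2 = (?w k)\<^sup>2 + 2 / ?x * (?w k * ?Y k) + (real_of_int k)\<^sup>2 / ?x\<^sup>2" for k
  proof -
    have "h_fun d \<theta> k + ?Y k / ?x - 1 = ?w k + ?Y k / ?x" by simp
    then show ?thesis by (simp only: power2_sum power_divide) simp
  qed
  have "phi \<theta> d = measure_pmf.expectation ?P (\<lambda>k. (?w k)\<^sup>2) + 2 / ?x * measure_pmf.expectation ?P (\<lambda>k. ?w k * ?Y k)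
      + ?x / ?x\<^sup>2"
    unfolding phi_def eq using iw2 iwY iY2 expectation_incr_pmf_square[OF x] by simp
  then have "d * phi \<theta> d - 1 / \<theta> = d * measure_pmf.expectation ?P (\<lambda>k. (?w k)\<^sup>2)
      + 2 / \<theta> * measure_pmf.expectation ?P (\<lambda>k. ?w k * ?Y k)"
    using assms by (simp add: field_simps power2_eq_square)
  also have "\<bar>\<dots>\<bar> \<le> d * B\<^sup>2 + 2 / \<theta> * (B * ?x)"
  proof -
    have 1: "\<bar>measure_pmf.expectation ?P (\<lambda>k. (?w k)\<^sup>2)\<bar> \<le> B\<^sup>2"
      using measure_pmf.integral_le_const[OF iw2, of "B\<^sup>2"] w2 by simp
    have "\<bar>measure_pmf.expectation ?P (\<lambda>k. ?w k * ?Y k)\<bar> \<le> measure_pmf.expectation ?P (\<lambda>k. \<bar>?w k * ?Y k\<bar>)"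
      by (rule integral_abs_bound)
    also have "\<dots> \<le> measure_pmf.expectation ?P (\<lambda>k. B * ?Y k)"
      using w by (intro integral_mono integrable_abs iwY integrable_mult_right iY) (auto simp: abs_mult intro!: mult_right_mono)
    also have "\<dots> \<le> B * ?x"
      using expectation_incr_pmf_abs_le[OF x] x by (simp add: B_def mult_left_mono)
    finally have 2: "\<bar>measure_pmf.expectation ?P (\<lambda>k. ?w k * ?Y k)\<bar> \<le> B * ?x" .
    show ?thesis
      using assms mult_left_mono[OF 1, of d] mult_left_mono[OF 2, of "2 / \<theta>"]
      by (intro order.trans[OF abs_triangle_ineq] add_mono) (simp_all only: abs_mult, simp_all)
  qed
  also have "2 / \<theta> * (B * ?x) = 2 * d * B" using assms by simp
  finally show ?thesis by (simp add: B_def)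
qed

lemma tendsto_phi:
  assumes "\<theta> > 0"
  shows "((\<lambda>d. T * d * phi \<theta> d) \<longlongrightarrow> T / \<theta>) (at_right 0)"
proof -
  have "((\<lambda>d. d * phi \<theta> d) \<longlongrightarrow> 1 / \<theta>) (at_right 0)"
  proof (rule LIM_zero_cancel, rule Lim_null_comparison)
    show "\<forall>\<^sub>F d in at_right 0. norm (d * phi \<theta> d - 1 / \<theta>) \<le> d * (1 + \<theta> * d)\<^sup>2 + 2 * d * (1 + \<theta> * d)"
      using abs_phi_le[OF assms] by (auto simp: eventually_at_right_less intro!: eventually_mono[OF eventually_at_right_less])
    show "((\<lambda>d. d * (1 + \<theta> * d)\<^sup>2 + 2 * d * (1 + \<theta> * d)) \<longlongrightarrow> 0) (at_right 0)"
      by (auto intro!: tendsto_eq_intros)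
  qed
  then have "((\<lambda>d. T * (d * phi \<theta> d)) \<longlongrightarrow> T * (1 / \<theta>)) (at_right 0)"
    by (intro tendsto_intros)
  then show ?thesis by (simp add: mult.assoc)
qed

section \<open>The likelihood ratio of a single increment\<close>

lemma f_incr_pos: "\<theta> * \<Delta> > 0 \<Longrightarrow> f_incr \<Delta> \<theta> k > 0"
  by (simp add: f_incr_def besselI_pos)

text \<open>Since \<open>pmf p\<close> vanishes nowhere, weighting by \<open>p\<close> cancels the
  denominator at every point and the total mass of \<open>q\<close> remains.\<close>

lemma
  assumes "\<And>x. pmf p x > 0"
  shows integrable_pmf_ratio: "integrable (measure_pmf p) (\<lambda>x. pmf q x / pmf p x)"
    and expectation_pmf_ratio: "measure_pmf.expectation p (\<lambda>x. pmf q x / pmf p x) = 1"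
proof -
  have "ennreal (pmf p x) * ennreal (pmf q x / pmf p x) = ennreal (pmf q x)" for x
    using assms[of x] by (simp flip: ennreal_mult)
  then have "(\<integral>\<^sup>+x. ennreal (pmf q x / pmf p x) \<partial>p) = (\<integral>\<^sup>+x. ennreal (pmf q x) \<partial>count_space UNIV)"
    by (simp add: nn_integral_measure_pmf)
  also have "\<dots> = ennreal 1" by (simp add: nn_integral_pmf)
  finally have "has_bochner_integral (measure_pmf p) (\<lambda>x. pmf q x / pmf p x) 1"
    by (intro has_bochner_integral_nn_integral) auto
  then show "integrable (measure_pmf p) (\<lambda>x. pmf q x / pmf p x)"
    "measure_pmf.expectation p (\<lambda>x. pmf q x / pmf p x) = 1"
    by (auto simp: has_bochner_integral_iff)
qed

definition log_ratio :: "real \<Rightarrow> real \<Rightarrow> real \<Rightarrow> int \<Rightarrow> real" where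
  "log_ratio \<Delta> \<theta> \<theta>' k = ln (f_incr \<Delta> \<theta>' k / f_incr \<Delta> \<theta> k)"

text \<open>The conditions hold for all large \<open>T\<close>. The bound on
  \<open>\<theta> * \<Delta>\<close> serves the moment estimates;
  \<open>2 * \<bar>\<theta>' - \<theta>\<bar> \<le> \<theta>\<close> keeps \<open>\<theta>'\<close>
  comparable to \<open>\<theta>\<close> and the logarithm expandable; together with
  \<open>\<Delta> \<le> 1\<close>, the last one yields
  \<open>\<bar>L k\<bar> \<le> Y k + 1\<close>.\<close>

locale local_shift =
  fixes \<theta> \<theta>' \<Delta> :: real
  assumes theta_pos: "\<theta> > 0" and Delta_pos: "\<Delta> > 0" and Delta_le: "\<Delta> \<le> 1" "\<theta> * \<Delta> \<le> 1"
    and shift: "2 * \<bar>\<theta>' - \<theta>\<bar> \<le> \<theta>" "2 * \<bar>\<theta>' - \<theta>\<bar> \<le> 1"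
begin

abbreviation "P \<equiv> incr_pmf \<theta> \<Delta>"
abbreviation "E \<equiv> measure_pmf.expectation P"
abbreviation "u \<equiv> \<theta>' - \<theta>"
abbreviation "Y \<equiv> \<lambda>k::int. \<bar>real_of_int k\<bar>"
abbreviation "L \<equiv> log_ratio \<Delta> \<theta> \<theta>'"
abbreviation "lam \<equiv> ln (\<theta>' / \<theta>)"
abbreviation "D \<equiv> \<lambda>k. L k - lam * Y k"

lemma theta'_bounds: "\<theta> / 2 \<le> \<theta>'" "\<theta>' \<le> 2 * \<theta>"
  using theta_pos shift by (auto simp: abs_if split: if_splits)

lemma theta'_pos: "\<theta>' > 0" using theta_pos theta'_bounds by linarith

lemma x_pos: "\<theta> * \<Delta> > 0" "\<theta>' * \<Delta> > 0" using theta_pos theta'_pos Delta_pos by auto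

lemma lam_approx: "\<bar>lam - u / \<theta>\<bar> \<le> 2 * (u / \<theta>)\<^sup>2"
proof -
  have "\<theta>' / \<theta> = 1 + u / \<theta>" using theta_pos by (simp add: field_simps)
  moreover have "\<bar>u / \<theta>\<bar> \<le> 1/2" using theta_pos shift by (simp add: abs_divide field_simps)
  ultimately show ?thesis using abs_ln_one_plus_x_minus_x_bound[of "u/\<theta>"] by simp
qed

lemma lam_le: "\<bar>lam\<bar> \<le> 2 * \<bar>u\<bar> / \<theta>"
proof -
  have z: "\<bar>u / \<theta>\<bar> \<le> 1/2" using theta_pos shift by (simp add: abs_divide field_simps)
  then have z: "2 * \<bar>u / \<theta>\<bar> \<le> 1" by linarith
  have "2 * (u / \<theta>)\<^sup>2 = \<bar>u / \<theta>\<bar> * (2 * \<bar>u / \<theta>\<bar>)" by (simp add: power2_eq_square)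
  also have "\<dots> \<le> \<bar>u / \<theta>\<bar> * 1" using z by (rule mult_left_mono) simp
  finally have "\<bar>lam\<bar> \<le> 2 * \<bar>u / \<theta>\<bar>" using lam_approx by linarith
  then show ?thesis using theta_pos by (simp add: abs_divide)
qed

lemma D_le: "\<bar>D k\<bar> \<le> 2 * \<bar>u\<bar> * \<Delta>"
proof -
  have "\<theta>' * \<Delta> \<le> 2 * \<theta> * \<Delta>" using theta'_bounds Delta_pos by (intro mult_right_mono) auto
  then have "(\<theta> + \<theta>') * \<Delta> \<le> 4" using Delta_le by (simp add: algebra_simps)
  then show ?thesis
    using abs_ln_f_incr_ratio_le[OF theta_pos theta'_pos Delta_pos, of k]
    by (simp add: log_ratio_def mult.commute)
qed

lemma exp_L: "exp (L k) = pmf (incr_pmf \<theta>' \<Delta>) k / pmf P k"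
  using x_pos by (simp add: log_ratio_def pmf_incr_pmf f_incr_pos)

lemma integrable_Y: "integrable P Y" and integrable_Y2: "integrable P (\<lambda>k. (real_of_int k)\<^sup>2)"
  and E_Y_le: "E Y \<le> \<theta> * \<Delta>" and E_Y2: "E (\<lambda>k. (real_of_int k)\<^sup>2) = \<theta> * \<Delta>"
  using x_pos integrable_incr_pmf_abs integrable_incr_pmf_square expectation_incr_pmf_abs_le
    expectation_incr_pmf_square by auto

lemma integrable_D: "integrable P D"
  by (rule measure_pmf.integrable_const_bound[where B="2 * \<bar>u\<bar> * \<Delta>"]) (use D_le in auto)

lemma D2_le: "(D k)\<^sup>2 \<le> 4 * u\<^sup>2 * \<Delta>\<^sup>2"
  using power_mono[OF D_le[of k], of 2] by (simp add: power_mult_distrib)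

lemma integrable_D2: "integrable P (\<lambda>k. (D k)\<^sup>2)"
  by (rule measure_pmf.integrable_const_bound[where B="4 * u\<^sup>2 * \<Delta>\<^sup>2"]) (use D2_le in auto)

lemma integrable_DY: "integrable P (\<lambda>k. D k * Y k)"
  by (rule Bochner_Integration.integrable_bound[of _ "\<lambda>k. (2 * \<bar>u\<bar> * \<Delta>) * Y k"])
     (use integrable_Y Delta_pos in \<open>auto simp: abs_mult intro!: mult_right_mono D_le\<close>)

lemma integrable_L: "integrable P L"
  using Bochner_Integration.integrable_add[OF integrable_D integrable_mult_right[OF integrable_Y, of lam]] by simp

lemma square_affine: "(c * Y k + D k)\<^sup>2 = c\<^sup>2 * (real_of_int k)\<^sup>2 + 2 * c * (D k * Y k) + (D k)\<^sup>2"
  by (simp add: power2_sum power_mult_distrib)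

lemma L2_eq: "(L k)\<^sup>2 = lam\<^sup>2 * (real_of_int k)\<^sup>2 + 2 * lam * (D k * Y k) + (D k)\<^sup>2"
  using square_affine[of lam k] by simp

lemma integrable_L2: "integrable P (\<lambda>k. (L k)\<^sup>2)"
  unfolding L2_eq using integrable_Y2 integrable_DY integrable_D2 by auto

text \<open>In the cross term both \<open>D\<close> and the mean of \<open>Y\<close> bring a factor
  \<open>\<Delta>\<close>, so it is as small as the mean of \<open>D^2\<close>. The constant is 8 +
  4.\<close>

lemma E_L2: "\<bar>E (\<lambda>k. (L k)\<^sup>2) - lam\<^sup>2 * (\<theta> * \<Delta>)\<bar> \<le> 12 * u\<^sup>2 * \<Delta>\<^sup>2"
proof -
  have 1: "\<bar>E (\<lambda>k. D k * Y k)\<bar> \<le> 2 * \<bar>u\<bar> * \<Delta> * (\<theta> * \<Delta>)"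
  proof -
    have "\<bar>E (\<lambda>k. D k * Y k)\<bar> \<le> E (\<lambda>k. \<bar>D k * Y k\<bar>)" by (rule integral_abs_bound)
    also have "\<dots> \<le> E (\<lambda>k. (2 * \<bar>u\<bar> * \<Delta>) * Y k)"
      using D_le by (intro integral_mono integrable_abs integrable_DY integrable_mult_right integrable_Y)
        (auto simp: abs_mult intro!: mult_right_mono)
    also have "\<dots> \<le> 2 * \<bar>u\<bar> * \<Delta> * (\<theta> * \<Delta>)"
      using E_Y_le Delta_pos by (auto intro!: mult_left_mono)
    finally show ?thesis .
  qed
  have 2: "\<bar>E (\<lambda>k. (D k)\<^sup>2)\<bar> \<le> 4 * u\<^sup>2 * \<Delta>\<^sup>2"
    using measure_pmf.integral_le_const[OF integrable_D2, of "4 * u\<^sup>2 * \<Delta>\<^sup>2"] D2_le by simp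
  have "E (\<lambda>k. (L k)\<^sup>2) - lam\<^sup>2 * (\<theta> * \<Delta>) = 2 * lam * E (\<lambda>k. D k * Y k) + E (\<lambda>k. (D k)\<^sup>2)"
    unfolding L2_eq using integrable_Y2 integrable_DY integrable_D2 E_Y2 by simp
  also have "\<bar>\<dots>\<bar> \<le> 2 * (2 * \<bar>u\<bar> / \<theta>) * (2 * \<bar>u\<bar> * \<Delta> * (\<theta> * \<Delta>)) + 4 * u\<^sup>2 * \<Delta>\<^sup>2"
    unfolding abs_mult using 1 2 lam_le theta_pos
    by (intro order.trans[OF abs_triangle_ineq] add_mono) (auto simp only: abs_mult intro!: mult_mono)
  also have "\<dots> = 8 * \<bar>u\<bar>\<^sup>2 * \<Delta>\<^sup>2 + 4 * u\<^sup>2 * \<Delta>\<^sup>2"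
    unfolding power2_eq_square using theta_pos by simp
  also have "\<dots> = 12 * u\<^sup>2 * \<Delta>\<^sup>2"
    unfolding power2_abs by simp
  finally show ?thesis .
qed

text \<open>The three summands belong to the constant part of \<open>remainder_bound\<close>, to its
  part with weight \<open>\<Delta>\<close> (using \<open>\<theta> * \<Delta> \<le> 1\<close>), and
  to its part with weight \<open>1/\<theta>^3\<close>, where the mean of the cubic term returns one
  factor \<open>\<theta>\<close>.\<close>

definition "drift_const = 8 * exp 1 * (exp 1 + cube_exp_const + cube_exp_const / \<theta>\<^sup>2)"

text \<open>Second-order Taylor formula with \<open>L\<close> dominated by
  \<open>2 * \<bar>u\<bar> * (Y / \<theta> + \<Delta>)\<close>. Each term on the right has an
  explicit factor \<open>\<Delta>\<close> or the factor \<open>Y^3 * exp Y\<close>, whose mean is of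
  order \<open>\<Delta>\<close>.\<close>

lemma remainder_bound:
  "\<bar>exp (L k) - 1 - L k - (L k)\<^sup>2 / 2\<bar>
     \<le> 16 * exp 1 * \<bar>u\<bar>^3 * (\<Delta> * exp 1 + (\<Delta> + 1/\<theta>^3) * (Y k ^ 3 * exp (Y k)))"
proof -
  define l where "l = \<bar>L k\<bar>"
  have sum: "(\<Sum>i\<le>2. L k ^ i / fact i) = 1 + L k + (L k)\<^sup>2 / 2"
    by (simp add: numeral_2_eq_2)
  have "\<bar>exp (L k) - 1 - L k - (L k)\<^sup>2 / 2\<bar> \<le> exp l * l ^ 3 / 2"
    using Taylor_exp_field[of "L k" 2] unfolding sum by (simp add: l_def numeral_3_eq_3 algebra_simps)
  have "L k = lam * Y k + D k" by simp
  then have "l \<le> \<bar>lam * Y k\<bar> + \<bar>D k\<bar>" unfolding l_def by (metis abs_triangle_ineq)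
  also have "\<bar>lam * Y k\<bar> + \<bar>D k\<bar> \<le> 2 * \<bar>u\<bar> / \<theta> * Y k + 2 * \<bar>u\<bar> * \<Delta>"
    using mult_right_mono[OF lam_le, of "Y k"] D_le[of k] by (simp add: abs_mult)
  finally have l: "l \<le> 2 * \<bar>u\<bar> / \<theta> * Y k + 2 * \<bar>u\<bar> * \<Delta>" .
  have "2 * \<bar>u\<bar> / \<theta> * Y k + 2 * \<bar>u\<bar> * \<Delta> \<le> 1 * Y k + 1 * 1"
    using shift theta_pos Delta_pos Delta_le by (intro add_mono mult_mono) (auto simp: divide_le_eq)
  with l have exp_l: "exp l \<le> exp 1 * exp (Y k)" by (simp flip: exp_add)
  have "l ^ 3 \<le> (2 * \<bar>u\<bar> / \<theta> * Y k + 2 * \<bar>u\<bar> * \<Delta>) ^ 3"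
    using l by (intro power_mono) (auto simp: l_def)
  also have "\<dots> = 8 * \<bar>u\<bar> ^ 3 * (Y k / \<theta> + \<Delta>) ^ 3"
  proof -
    have "2 * \<bar>u\<bar> / \<theta> * Y k + 2 * \<bar>u\<bar> * \<Delta> = 2 * \<bar>u\<bar> * (Y k / \<theta> + \<Delta>)" by (simp add: algebra_simps)
    then show ?thesis by (simp only: power_mult_distrib) simp
  qed
  \<comment> \<open>Convexity of the cube, which separates the powers of \<open>Y\<close> and
    \<open>\<Delta>\<close>.\<close>
  also have "\<dots> \<le> 8 * \<bar>u\<bar> ^ 3 * (4 * ((Y k / \<theta>) ^ 3 + \<Delta> ^ 3))"
  proof (intro mult_left_mono)
    have "(a + b) ^ 3 \<le> 4 * (a ^ 3 + b ^ 3)" if "a \<ge> 0" "b \<ge> 0" for a b :: real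
    proof -
      have "4 * (a ^ 3 + b ^ 3) - (a + b) ^ 3 = 3 * (a + b) * (a - b)\<^sup>2"
        by (simp add: power2_eq_square power3_eq_cube algebra_simps)
      moreover have "\<dots> \<ge> 0" using that by simp
      ultimately show ?thesis by linarith
    qed
    then show "(Y k / \<theta> + \<Delta>) ^ 3 \<le> 4 * ((Y k / \<theta>) ^ 3 + \<Delta> ^ 3)" using theta_pos Delta_pos by simp
  qed simp
  finally have l3: "l ^ 3 \<le> 32 * \<bar>u\<bar> ^ 3 * ((Y k / \<theta>) ^ 3 + \<Delta> ^ 3)" by (simp add: algebra_simps)
  have "exp l * l ^ 3 \<le> (exp 1 * exp (Y k)) * (32 * \<bar>u\<bar> ^ 3 * ((Y k / \<theta>) ^ 3 + \<Delta> ^ 3))"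
    using exp_l l3 by (intro mult_mono) (auto simp: l_def)
  also have "\<dots> = 32 * exp 1 * \<bar>u\<bar>^3 * (\<Delta>^3 * exp (Y k) + 1/\<theta>^3 * (Y k ^ 3 * exp (Y k)))"
    by (simp add: power_divide algebra_simps)
  also have "\<dots> \<le> 32 * exp 1 * \<bar>u\<bar>^3 * (\<Delta> * (exp 1 + Y k ^ 3 * exp (Y k)) + 1/\<theta>^3 * (Y k ^ 3 * exp (Y k)))"
  proof (intro mult_left_mono add_right_mono mult_mono)
    show "\<Delta> ^ 3 \<le> \<Delta>" using power_decreasing[of 1 3 \<Delta>] Delta_pos Delta_le by simp
    \<comment> \<open>At \<open>k = 0\<close> the constant suffices; elsewhere
      \<open>Y k \<ge> 1\<close> lets the cubic term absorb the exponential.\<close>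
    show "exp (Y k) \<le> exp 1 + Y k ^ 3 * exp (Y k)"
    proof (cases "k = 0")
      case False
      then have "Y k \<ge> 1" by simp
      then have "1 * exp (Y k) \<le> Y k ^ 3 * exp (Y k)" by (intro mult_right_mono one_le_power) auto
      then show ?thesis using exp_ge_zero[of "1::real"] by linarith
    qed simp
  qed (use Delta_pos in auto)
  finally have "exp l * l ^ 3 / 2 \<le> 16 * exp 1 * \<bar>u\<bar>^3 * (\<Delta> * exp 1 + (\<Delta> + 1/\<theta>^3) * (Y k ^ 3 * exp (Y k)))"
    by (simp add: algebra_simps)
  then show ?thesis using \<open>\<bar>exp (L k) - 1 - L k - (L k)\<^sup>2 / 2\<bar> \<le> exp l * l ^ 3 / 2\<close> by linarith
qed

text \<open>Since the likelihood ratio has mean one, \<open>E L = - E (exp L - 1 - L)\<close>, which turns the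
  drift of the log-likelihood into a second moment.\<close>

lemma E_L: "\<bar>E L + lam\<^sup>2 * (\<theta> * \<Delta>) / 2\<bar> \<le> 6 * u\<^sup>2 * \<Delta>\<^sup>2 + 2 * drift_const * \<bar>u\<bar>^3 * \<Delta>"
proof -
  let ?R = "\<lambda>k. exp (L k) - 1 - L k - (L k)\<^sup>2 / 2"
  let ?Z = "\<lambda>k. Y k ^ 3 * exp (Y k)"
  have pos: "pmf P k > 0" for k using x_pos by (simp add: pmf_incr_pmf f_incr_pos)
  have iZ: "integrable P ?Z" and EZ: "E ?Z \<le> cube_exp_const * (\<theta> * \<Delta>)"
    using integrable_incr_pmf_cube_exp[OF x_pos(1)] expectation_incr_pmf_cube_exp_le[OF x_pos(1)] Delta_le by auto
  have iE: "integrable P (\<lambda>k. exp (L k))" and EE: "E (\<lambda>k. exp (L k)) = 1"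
    unfolding exp_L using integrable_pmf_ratio expectation_pmf_ratio pos by auto
  have iR: "integrable P ?R" using iE integrable_L integrable_L2 by auto
  have ER: "E ?R = - E L - E (\<lambda>k. (L k)\<^sup>2) / 2" using iE EE integrable_L integrable_L2 by simp
  note C = cube_exp_const_nonneg
  have "\<bar>E ?R\<bar> \<le> E (\<lambda>k. \<bar>?R k\<bar>)" by (rule integral_abs_bound)
  also have "\<dots> \<le> E (\<lambda>k. 16 * exp 1 * \<bar>u\<bar>^3 * (\<Delta> * exp 1 + (\<Delta> + 1/\<theta>^3) * ?Z k))"
    using iZ by (intro integral_mono integrable_abs iR remainder_bound integrable_mult_right
      Bochner_Integration.integrable_add) auto
  also have "\<dots> = 16 * exp 1 * \<bar>u\<bar>^3 * (\<Delta> * exp 1 + (\<Delta> + 1/\<theta>^3) * E ?Z)"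
    using iZ by simp
  also have "\<dots> \<le> 16 * exp 1 * \<bar>u\<bar>^3 * (\<Delta> * exp 1 + (\<Delta> + 1/\<theta>^3) * (cube_exp_const * (\<theta> * \<Delta>)))"
    using EZ Delta_pos theta_pos by (intro mult_left_mono add_left_mono) auto
  also have "\<dots> = 16 * exp 1 * \<bar>u\<bar>^3 * (\<Delta> * exp 1 + \<Delta> * (cube_exp_const * (\<theta> * \<Delta>)) + \<Delta> * (cube_exp_const / \<theta>\<^sup>2))"
    using theta_pos by (simp add: field_simps power2_eq_square power3_eq_cube)
  also have "\<dots> \<le> 16 * exp 1 * \<bar>u\<bar>^3 * (\<Delta> * exp 1 + \<Delta> * (cube_exp_const * 1) + \<Delta> * (cube_exp_const / \<theta>\<^sup>2))"
    using Delta_le Delta_pos C by (intro mult_left_mono add_mono order_refl) auto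
  also have "\<dots> = 2 * drift_const * \<bar>u\<bar>^3 * \<Delta>"
    by (simp add: drift_const_def algebra_simps)
  finally have "\<bar>E ?R\<bar> \<le> 2 * drift_const * \<bar>u\<bar>^3 * \<Delta>" .
  moreover have "E L + lam\<^sup>2 * (\<theta> * \<Delta>) / 2 = - E ?R - (E (\<lambda>k. (L k)\<^sup>2) - lam\<^sup>2 * (\<theta> * \<Delta>)) / 2"
    using ER by (simp add: field_simps)
  ultimately show ?thesis using E_L2 by (simp add: abs_le_iff field_simps)
qed

text \<open>The subtracted coefficient is \<open>u / \<theta>\<close>, not \<open>lam\<close>,
  because \<open>u / \<theta>\<close> becomes exactly \<open>v / sqrt (\<theta> * T)\<close> for the
  LAN shift. Being centred, \<open>R\<close> enters only through its second moment.\<close>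

definition "R k = (L k - E L) - u / \<theta> * (Y k - E Y)"

text \<open>Up to a constant, \<open>R\<close> is \<open>(lam - u / \<theta>) * Y + D\<close>, and
  centring can only lower the second moment. The first part is of order
  \<open>u^4 * \<Delta>\<close>, the second of order \<open>u^2 * \<Delta>^2\<close>. After
  summation they become of order \<open>1 / T\<close> and \<open>\<Delta>\<close>; the latter
  vanishes because of the high-frequency sampling.\<close>

lemma integrable_R: "integrable P R" and E_R: "E R = 0"
  and integrable_R2: "integrable P (\<lambda>k. (R k)\<^sup>2)"
  and E_R2: "E (\<lambda>k. (R k)\<^sup>2) \<le> 8 * (u / \<theta>)^4 * (\<theta> * \<Delta>) + 8 * u\<^sup>2 * \<Delta>\<^sup>2"
proof -
  define c where "c = lam - u / \<theta>"
  define Q where "Q = (\<lambda>k. c * Y k + D k)"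
  define m where "m = E Q"
  have iQ: "integrable P Q" unfolding Q_def using integrable_Y integrable_D by auto
  have iQ2: "integrable P (\<lambda>k. (Q k)\<^sup>2)"
    unfolding Q_def square_affine using integrable_Y2 integrable_DY integrable_D2 by auto
  have Q: "Q k = L k - u / \<theta> * Y k" for k unfolding Q_def c_def by (simp add: algebra_simps)
  have R: "R = (\<lambda>k. Q k - m)"
    unfolding m_def Q R_def using integrable_L integrable_Y by (simp add: fun_eq_iff algebra_simps)
  show "integrable P R" "E R = 0" unfolding R using iQ by (auto simp: m_def)
  have R2: "(R k)\<^sup>2 = (Q k)\<^sup>2 - 2 * m * Q k + m\<^sup>2" for k unfolding R by (simp add: power2_diff)
  show "integrable P (\<lambda>k. (R k)\<^sup>2)" unfolding R2 using iQ iQ2 by auto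
  have "E (\<lambda>k. (R k)\<^sup>2) = E (\<lambda>k. (Q k)\<^sup>2) - m\<^sup>2"
    unfolding R2 using iQ iQ2 by (simp add: m_def power2_eq_square)
  also have "\<dots> \<le> E (\<lambda>k. (Q k)\<^sup>2)" by simp
  also have "\<dots> \<le> E (\<lambda>k. 2 * c\<^sup>2 * (real_of_int k)\<^sup>2 + 8 * u\<^sup>2 * \<Delta>\<^sup>2)"
  proof (intro integral_mono iQ2)
    fix k
    have "(Q k)\<^sup>2 \<le> 2 * (c * Y k)\<^sup>2 + 2 * (D k)\<^sup>2"
      unfolding Q_def using sum_squares_bound[of "c * Y k" "D k"] by (simp add: power2_sum)
    then show "(Q k)\<^sup>2 \<le> 2 * c\<^sup>2 * (real_of_int k)\<^sup>2 + 8 * u\<^sup>2 * \<Delta>\<^sup>2"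
      using D2_le[of k] by (simp add: power_mult_distrib)
  qed (use integrable_Y2 in auto)
  also have "\<dots> = 2 * c\<^sup>2 * (\<theta> * \<Delta>) + 8 * u\<^sup>2 * \<Delta>\<^sup>2"
    using integrable_Y2 E_Y2 by simp
  also have "\<dots> \<le> 2 * (4 * (u/\<theta>)^4) * (\<theta> * \<Delta>) + 8 * u\<^sup>2 * \<Delta>\<^sup>2"
  proof -
    have "c\<^sup>2 \<le> (2 * (u/\<theta>)\<^sup>2)\<^sup>2" using power_mono[OF lam_approx, of 2] by (simp add: c_def)
    then have "c\<^sup>2 \<le> 4 * (u/\<theta>)^4" by (simp add: power_mult_distrib power_divide flip: power_mult)
    then show ?thesis using x_pos by (intro add_right_mono mult_right_mono) auto
  qed
  finally show "E (\<lambda>k. (R k)\<^sup>2) \<le> 8 * (u / \<theta>)^4 * (\<theta> * \<Delta>) + 8 * u\<^sup>2 * \<Delta>\<^sup>2" by simp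
qed

end

section \<open>A central limit theorem for triangular arrays\<close>

text \<open>The upper half combines \<open>exp s \<ge> 1 + s + s^2 / 2\<close> with
  \<open>(1 - s + s^2 / 2) * (1 + s + s^2 / 2) = 1 + s^4 / 4\<close>, which avoids a case
  distinction for large \<open>s\<close>.\<close>

lemma exp_minus_quadratic_bound:
  fixes s :: real assumes "s \<ge> 0" shows "\<bar>exp (-s) - (1 - s)\<bar> \<le> s\<^sup>2 / 2"
proof -
  have "exp (-s) \<le> 1 - s + s\<^sup>2 / 2"
  proof -
    have "1 = exp (-s) * exp s" by (simp flip: exp_add)
    also have "\<dots> \<ge> exp (-s) * (1 + s + s\<^sup>2 / 2)"
      using exp_lower_Taylor_quadratic[OF assms] by (intro mult_left_mono) auto
    finally have "exp (-s) * (1 + s + s\<^sup>2 / 2) \<le> 1" .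
    also have "1 \<le> (1 - s + s\<^sup>2 / 2) * (1 + s + s\<^sup>2 / 2)"
    proof -
      have "(1 - s + s\<^sup>2 / 2) * (1 + s + s\<^sup>2 / 2) = 1 + (s\<^sup>2 / 2)\<^sup>2"
        by (simp add: power2_eq_square algebra_simps)
      then show ?thesis by simp
    qed
    finally show ?thesis
      by (rule mult_right_le_imp_le) (use assms in \<open>auto intro!: add_pos_nonneg\<close>)
  qed
  then show ?thesis using exp_ge_add_one_self[of "-s"] by (simp add: abs_le_iff)
qed

lemma char_replicate_pmf:
  fixes f :: "'a \<Rightarrow> real"
  shows "char (distr (measure_pmf (replicate_pmf n p)) borel (\<lambda>xs. sum_list (map f xs))) t
    = char (distr (measure_pmf p) borel f) t ^ n"
proof -
  have "iexp (t * sum_list (map f xs)) = prod_list (map (\<lambda>x. iexp (t * f x)) xs)" for xs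
    by (induction xs) (simp_all add: exp_add algebra_simps)
  moreover have "integrable (measure_pmf p) (\<lambda>x. iexp (t * f x))"
    by (rule measure_pmf.integrable_const_bound[where B=1]) auto
  ultimately show ?thesis
    using expectation_replicate_pmf_prod[of p "\<lambda>x. iexp (t * f x)" n]
    by (simp add: char_def integral_distr)
qed

text \<open>The comparison is with powers of \<open>exp (-s)\<close> instead of
  \<open>1 - s\<close>: both bases then have modulus at most 1 for every \<open>t\<close>, so the
  difference of the powers is at most \<open>n\<close> times that of the bases.\<close>

lemma char_replicate_pmf_bound:
  fixes f :: "'a \<Rightarrow> real"
  assumes f: "integrable (measure_pmf p) f" and f2: "integrable (measure_pmf p) (\<lambda>x. (f x)\<^sup>2)"
    and f3: "integrable (measure_pmf p) (\<lambda>x. \<bar>f x\<bar> ^ 3)" and z: "measure_pmf.expectation p f = 0"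
  defines "v \<equiv> measure_pmf.expectation p (\<lambda>x. (f x)\<^sup>2)"
  shows "cmod (char (distr (measure_pmf (replicate_pmf n p)) borel (\<lambda>xs. sum_list (map f xs))) t
      - complex_of_real (exp (- (t\<^sup>2 * (n * v) / 2))))
    \<le> \<bar>t\<bar>^3 * (n * measure_pmf.expectation p (\<lambda>x. \<bar>f x\<bar> ^ 3)) + t^4 * ((n * v) * v)"
proof -
  let ?c = "char (distr (measure_pmf p) borel f) t"
  define s where "s = t\<^sup>2 * v / 2"
  define e3 where "e3 = measure_pmf.expectation p (\<lambda>x. \<bar>f x\<bar> ^ 3)"
  have v: "v \<ge> 0" unfolding v_def by simp
  then have s: "s \<ge> 0" by (simp add: s_def)
  have "cmod (?c - (1 - t\<^sup>2 * v / 2)) \<le> t\<^sup>2 / 6 * measure_pmf.expectation p (\<lambda>x. min (6 * (f x)\<^sup>2) (\<bar>t\<bar> * \<bar>f x\<bar>^3))"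
    by (rule prob_space.char_approx3'[OF measure_pmf.prob_space_axioms])
       (use f f2 z in \<open>auto simp: v_def\<close>)
  also have "\<dots> \<le> t\<^sup>2 / 6 * (\<bar>t\<bar> * e3)"
  proof (rule mult_left_mono)
    have "measure_pmf.expectation p (\<lambda>x. min (6 * (f x)\<^sup>2) (\<bar>t\<bar> * \<bar>f x\<bar>^3)) \<le> measure_pmf.expectation p (\<lambda>x. \<bar>t\<bar> * \<bar>f x\<bar>^3)"
      using f2 f3 by (intro integral_mono integrable_min) auto
    then show "measure_pmf.expectation p (\<lambda>x. min (6 * (f x)\<^sup>2) (\<bar>t\<bar> * \<bar>f x\<bar>^3)) \<le> \<bar>t\<bar> * e3"
      unfolding e3_def by simp
  qed simp
  also have "t\<^sup>2 / 6 * (\<bar>t\<bar> * e3) = \<bar>t\<bar>^3 * e3 / 6"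
    by (simp add: power3_eq_cube power2_eq_square mult.assoc)
  finally have 1: "cmod (?c - complex_of_real (1 - s)) \<le> \<bar>t\<bar>^3 * e3 / 6"
    by (simp add: s_def)
  have "cmod (complex_of_real (exp (-s)) - complex_of_real (1 - s)) = \<bar>exp (-s) - (1 - s)\<bar>"
    by (simp only: of_real_diff[symmetric] norm_of_real)
  then have 2: "cmod (complex_of_real (exp (-s)) - complex_of_real (1 - s)) \<le> s\<^sup>2 / 2"
    using exp_minus_quadratic_bound[OF s] by simp
  have "cmod (?c - complex_of_real (exp (-s))) \<le> \<bar>t\<bar>^3 * e3 / 6 + s\<^sup>2 / 2"
    using norm_triangle_ineq4[of "?c - complex_of_real (1 - s)" "complex_of_real (exp (-s)) - complex_of_real (1 - s)"] 1 2
    by simp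
  also have "\<dots> \<le> \<bar>t\<bar>^3 * e3 + t^4 * v\<^sup>2"
  proof (rule add_mono)
    have "e3 \<ge> 0" unfolding e3_def by simp
    then show "\<bar>t\<bar>^3 * e3 / 6 \<le> \<bar>t\<bar>^3 * e3" by simp
    have "s\<^sup>2 / 2 = t^4 * v\<^sup>2 / 8" by (simp add: s_def power_divide power_mult_distrib flip: power_mult)
    moreover have "0 \<le> t^4 * v\<^sup>2" by simp
    ultimately show "s\<^sup>2 / 2 \<le> t^4 * v\<^sup>2" by linarith
  qed
  finally have b: "cmod (?c - complex_of_real (exp (-s))) \<le> \<bar>t\<bar>^3 * e3 + t^4 * v\<^sup>2" .
  have rd: "real_distribution (distr (measure_pmf p) borel f)"
    by (rule prob_space.real_distribution_distr[OF measure_pmf.prob_space_axioms]) simp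
  have "cmod (?c ^ n - complex_of_real (exp (-s)) ^ n) \<le> n * cmod (?c - complex_of_real (exp (-s)))"
    using s by (intro norm_power_diff real_distribution.cmod_char_le_1[OF rd]) simp
  also have "\<dots> \<le> n * (\<bar>t\<bar>^3 * e3 + t^4 * v\<^sup>2)" using b by (intro mult_left_mono) auto
  finally have "cmod (?c ^ n - complex_of_real (exp (-s)) ^ n) \<le> \<bar>t\<bar>^3 * (n * e3) + t^4 * ((n * v) * v)"
    by (simp add: algebra_simps power2_eq_square)
  moreover have "complex_of_real (exp (-s)) ^ n = complex_of_real (exp (- (t\<^sup>2 * (n * v) / 2)))"
    by (simp add: s_def algebra_simps flip: of_real_power exp_of_nat_mult)
  ultimately show ?thesis
    unfolding char_replicate_pmf e3_def by simp
qed

text \<open>\<open>e3\<close> is the Lyapunov condition; \<open>v0\<close> removes the quartic error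
  term. Integrability and centring are asked for large \<open>T\<close> only, where the increment
  estimates apply.\<close>

lemma replicate_pmf_clt:
  fixes p :: "real \<Rightarrow> 'a pmf" and f :: "real \<Rightarrow> 'a \<Rightarrow> real" and n :: "real \<Rightarrow> nat"
  assumes f: "\<forall>\<^sub>F T in at_top. integrable (measure_pmf (p T)) (f T)"
    and f2: "\<forall>\<^sub>F T in at_top. integrable (measure_pmf (p T)) (\<lambda>x. (f T x)\<^sup>2)"
    and f3: "\<forall>\<^sub>F T in at_top. integrable (measure_pmf (p T)) (\<lambda>x. \<bar>f T x\<bar> ^ 3)"
    and z: "\<forall>\<^sub>F T in at_top. measure_pmf.expectation (p T) (f T) = 0"
    and v1: "((\<lambda>T. n T * measure_pmf.expectation (p T) (\<lambda>x. (f T x)\<^sup>2)) \<longlongrightarrow> 1) at_top"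
    and v0: "((\<lambda>T. measure_pmf.expectation (p T) (\<lambda>x. (f T x)\<^sup>2)) \<longlongrightarrow> 0) at_top"
    and e3: "((\<lambda>T. n T * measure_pmf.expectation (p T) (\<lambda>x. \<bar>f T x\<bar> ^ 3)) \<longlongrightarrow> 0) at_top"
  shows "conv_distr_at_top
    (\<lambda>T. distr (measure_pmf (replicate_pmf (n T) (p T))) borel (\<lambda>xs. sum_list (map (f T) xs))) std_normal_distribution"
proof -
  let ?M = "\<lambda>T. distr (measure_pmf (replicate_pmf (n T) (p T))) borel (\<lambda>xs. sum_list (map (f T) xs))"
  let ?v = "\<lambda>T. measure_pmf.expectation (p T) (\<lambda>x. (f T x)\<^sup>2)"
  let ?e3 = "\<lambda>T. measure_pmf.expectation (p T) (\<lambda>x. \<bar>f T x\<bar> ^ 3)"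
  have char: "((\<lambda>T. char (?M T) t) \<longlongrightarrow> char std_normal_distribution t) at_top" for t
  proof -
    have "((\<lambda>T. char (?M T) t - complex_of_real (exp (- (t\<^sup>2 * (n T * ?v T) / 2)))) \<longlongrightarrow> 0) at_top"
    proof (rule Lim_null_comparison)
      show "\<forall>\<^sub>F T in at_top. cmod (char (?M T) t - complex_of_real (exp (- (t\<^sup>2 * (n T * ?v T) / 2))))
          \<le> \<bar>t\<bar>^3 * (n T * ?e3 T) + t^4 * ((n T * ?v T) * ?v T)"
        using f f2 f3 z by eventually_elim (rule char_replicate_pmf_bound)
      show "((\<lambda>T. \<bar>t\<bar>^3 * (n T * ?e3 T) + t^4 * ((n T * ?v T) * ?v T)) \<longlongrightarrow> 0) at_top"
        by (rule tendsto_eq_intros v1 v0 e3 refl | simp)+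
    qed
    moreover have "((\<lambda>T. complex_of_real (exp (- (t\<^sup>2 * (n T * ?v T) / 2)))) \<longlongrightarrow> complex_of_real (exp (- (t\<^sup>2 * 1 / 2)))) at_top"
      by (intro tendsto_intros v1) simp
    ultimately have "((\<lambda>T. char (?M T) t) \<longlongrightarrow> 0 + complex_of_real (exp (- (t\<^sup>2 * 1 / 2)))) at_top"
      using tendsto_add by fastforce
    then show ?thesis by (simp add: char_std_normal_distribution)
  qed
  show ?thesis
    unfolding conv_distr_at_top_def
  \<comment> \<open>Levy's continuity theorem speaks of sequences, so the limit along the reals is
    tested on arbitrary sequences tending to infinity.\<close>
  proof (intro allI impI tendsto_at_topI_sequentially)
    fix x :: real and X :: "nat \<Rightarrow> real"
    assume x: "isCont (cdf std_normal_distribution) x" and X: "filterlim X at_top sequentially"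
    have "weak_conv_m (\<lambda>k. ?M (X k)) std_normal_distribution"
    proof (rule levy_continuity)
      show "real_distribution (?M (X k))" for k
        by (rule prob_space.real_distribution_distr[OF measure_pmf.prob_space_axioms]) simp
      show "(\<lambda>k. char (?M (X k)) t) \<longlonglongrightarrow> char std_normal_distribution t" for t
        by (rule filterlim_compose[OF char X])
    qed (rule real_dist_normal_dist)
    then show "(\<lambda>k. cdf (?M (X k)) x) \<longlonglongrightarrow> cdf std_normal_distribution x"
      using x by (simp add: weak_conv_m_def weak_conv_def)
  qed
qed

section \<open>The observed path and its likelihood ratio\<close>

definition increments :: "int list \<Rightarrow> int list" where
  "increments ys = map (\<lambda>i. ys ! Suc i - ys ! i) [0..<length ys - 1]"

text \<open>The central sequence must be a function of the observed path, so the increments are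
  decoded from it. The path contains the initial 0 and is one entry longer, hence the
  \<open>length ys - 1\<close>.\<close>

lemma increments_partial_sums [simp]: "increments (partial_sums xs) = xs"
  unfolding increments_def partial_sums_def
  by (rule nth_equalityI) (simp_all add: take_Suc_conv_app_nth del: upt_Suc)

lemma inj_partial_sums: "inj partial_sums"
  by (rule inj_on_inverseI[of _ increments]) simp

lemma pmf_obs_pmf:
  "pmf (obs_pmf T \<Delta> \<theta>) (partial_sums xs) = pmf (replicate_pmf (nat \<lfloor>T / \<Delta>\<rfloor>) (incr_pmf \<theta> \<Delta>)) xs"
  unfolding obs_pmf_def by (rule pmf_map_inj'[OF inj_partial_sums])

lemma obs_pmf_ratio:
  assumes "\<theta> * \<Delta> > 0" "\<theta>' * \<Delta> > 0" "length xs = nat \<lfloor>T / \<Delta>\<rfloor>"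
  shows "pmf (obs_pmf T \<Delta> \<theta>') (partial_sums xs) / pmf (obs_pmf T \<Delta> \<theta>) (partial_sums xs)
    = exp (sum_list (map (log_ratio \<Delta> \<theta> \<theta>') xs))"
proof -
  have "prod_list (map (f_incr \<Delta> \<theta>') xs) / prod_list (map (f_incr \<Delta> \<theta>) xs)
      = exp (sum_list (map (log_ratio \<Delta> \<theta> \<theta>') xs))"
    by (induction xs) (simp_all add: exp_add log_ratio_def f_incr_pos assms times_divide_times_eq[symmetric]
      del: times_divide_times_eq)
  moreover have "pmf (incr_pmf \<theta> \<Delta>) = f_incr \<Delta> \<theta>" "pmf (incr_pmf \<theta>' \<Delta>) = f_incr \<Delta> \<theta>'"
    using assms by (auto simp: pmf_incr_pmf)
  ultimately show ?thesis using assms(3) by (simp add: pmf_obs_pmf pmf_replicate_pmf)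
qed

section \<open>Local asymptotic normality\<close>

lemma abs_diff_cube_le:
  fixes a b :: real assumes "a \<ge> 0" "b \<ge> 0" shows "\<bar>a - b\<bar> ^ 3 \<le> a ^ 3 + b ^ 3"
proof -
  have "\<bar>a - b\<bar> \<le> max a b" using assms by auto
  then have "\<bar>a - b\<bar> ^ 3 \<le> max a b ^ 3" by (intro power_mono) auto
  also have "\<dots> \<le> a ^ 3 + b ^ 3" using assms by (auto simp: max_def)
  finally show ?thesis .
qed

lemma sum_list_map_affine:
  fixes f g :: "'a \<Rightarrow> real" and a c :: real
  shows "sum_list (map (\<lambda>x. (f x - a) - c * g x) xs) = sum_list (map f xs) - length xs * a - c * sum_list (map g xs)"
  by (induction xs) (simp_all add: algebra_simps)

definition centred_abs :: "real \<Rightarrow> real \<Rightarrow> int \<Rightarrow> real" where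
  "centred_abs \<theta> \<Delta> k = \<bar>real_of_int k\<bar> - measure_pmf.expectation (incr_pmf \<theta> \<Delta>) (\<lambda>k. \<bar>real_of_int k\<bar>)"

text \<open>The variance is \<open>\<theta> * \<Delta>\<close> minus the squared mean, which is of
  order \<open>\<Delta>^2\<close>. For the third moment,
  \<open>\<bar>Y - m\<bar>^3 \<le> Y^3 + m^3\<close> reduces to the cubic exponential
  moment.\<close>

lemma
  assumes x: "\<theta> * \<Delta> > 0"
  shows integrable_centred_abs: "integrable (incr_pmf \<theta> \<Delta>) (centred_abs \<theta> \<Delta>)"
    and expectation_centred_abs: "measure_pmf.expectation (incr_pmf \<theta> \<Delta>) (centred_abs \<theta> \<Delta>) = 0"
    and integrable_centred_abs_square: "integrable (incr_pmf \<theta> \<Delta>) (\<lambda>k. (centred_abs \<theta> \<Delta> k)\<^sup>2)"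
    and expectation_centred_abs_square:
      "\<bar>measure_pmf.expectation (incr_pmf \<theta> \<Delta>) (\<lambda>k. (centred_abs \<theta> \<Delta> k)\<^sup>2) - \<theta> * \<Delta>\<bar> \<le> (\<theta> * \<Delta>)\<^sup>2"
    and integrable_centred_abs_cube: "integrable (incr_pmf \<theta> \<Delta>) (\<lambda>k. \<bar>centred_abs \<theta> \<Delta> k\<bar> ^ 3)"
    and expectation_centred_abs_cube: "\<theta> * \<Delta> \<le> 1 \<Longrightarrow>
      measure_pmf.expectation (incr_pmf \<theta> \<Delta>) (\<lambda>k. \<bar>centred_abs \<theta> \<Delta> k\<bar> ^ 3) \<le> (cube_exp_const + 1) * (\<theta> * \<Delta>)"
proof -
  let ?P = "incr_pmf \<theta> \<Delta>" and ?W = "centred_abs \<theta> \<Delta>" and ?Z = "\<lambda>k. \<bar>real_of_int k\<bar> ^ 3 * exp \<bar>real_of_int k\<bar>"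
  define m where "m = measure_pmf.expectation ?P (\<lambda>k. \<bar>real_of_int k\<bar>)"
  have m: "0 \<le> m" "m \<le> \<theta> * \<Delta>" unfolding m_def using expectation_incr_pmf_abs_le[OF x] by auto
  have W: "?W = (\<lambda>k. \<bar>real_of_int k\<bar> - m)" by (simp add: centred_abs_def fun_eq_iff m_def)
  note i = integrable_incr_pmf_abs[OF x] integrable_incr_pmf_square[OF x]
  show "integrable ?P ?W" "measure_pmf.expectation ?P ?W = 0" unfolding W using i by (auto simp: m_def)
  have W2: "(?W k)\<^sup>2 = (real_of_int k)\<^sup>2 - 2 * m * \<bar>real_of_int k\<bar> + m\<^sup>2" for k
    unfolding W by (simp add: power2_diff)
  show "integrable ?P (\<lambda>k. (?W k)\<^sup>2)" unfolding W2 using i by auto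
  have "measure_pmf.expectation ?P (\<lambda>k. (?W k)\<^sup>2) = \<theta> * \<Delta> - m\<^sup>2"
    unfolding W2 using i expectation_incr_pmf_square[OF x] by (simp add: m_def[symmetric] power2_eq_square)
  moreover have "m\<^sup>2 \<le> (\<theta> * \<Delta>)\<^sup>2" using m by (intro power_mono)
  ultimately show "\<bar>measure_pmf.expectation ?P (\<lambda>k. (?W k)\<^sup>2) - \<theta> * \<Delta>\<bar> \<le> (\<theta> * \<Delta>)\<^sup>2" by simp
  have le: "\<bar>?W k\<bar> ^ 3 \<le> ?Z k + m ^ 3" for k
  proof -
    have "\<bar>real_of_int k\<bar> ^ 3 * 1 \<le> ?Z k" by (intro mult_left_mono) auto
    then show ?thesis using abs_diff_cube_le[of "\<bar>real_of_int k\<bar>" m] m unfolding W by simp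
  qed
  have iZ: "integrable ?P (\<lambda>k. ?Z k + m ^ 3)" using integrable_incr_pmf_cube_exp[OF x] by auto
  show iW3: "integrable ?P (\<lambda>k. \<bar>?W k\<bar> ^ 3)"
    by (rule Bochner_Integration.integrable_bound[OF iZ]) (use le in \<open>auto intro!: order.trans[OF le abs_ge_self]\<close>)
  assume x1: "\<theta> * \<Delta> \<le> 1"
  have "measure_pmf.expectation ?P (\<lambda>k. \<bar>?W k\<bar> ^ 3) \<le> measure_pmf.expectation ?P (\<lambda>k. ?Z k + m ^ 3)"
    by (intro integral_mono iW3 iZ le)
  also have "\<dots> \<le> cube_exp_const * (\<theta> * \<Delta>) + m ^ 3"
    using integrable_incr_pmf_cube_exp[OF x] expectation_incr_pmf_cube_exp_le[OF x x1] by simp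
  also have "m ^ 3 \<le> (\<theta> * \<Delta>) ^ 3" using m by (intro power_mono)
  also have "\<dots> \<le> \<theta> * \<Delta>" using power_decreasing[of 1 3 "\<theta> * \<Delta>"] x x1 by simp
  finally show "measure_pmf.expectation ?P (\<lambda>k. \<bar>?W k\<bar> ^ 3) \<le> (cube_exp_const + 1) * (\<theta> * \<Delta>)"
    by (simp add: algebra_simps)
qed

locale high_frequency =
  fixes \<theta> :: real and \<Delta> :: "real \<Rightarrow> real"
  assumes theta_pos: "\<theta> > 0"
    and Delta: "\<And>T. T > 0 \<Longrightarrow> 0 < \<Delta> T \<and> \<Delta> T \<le> T"
    and Delta_tendsto: "(\<Delta> \<longlongrightarrow> 0) at_top"
begin

abbreviation "n T \<equiv> nat \<lfloor>T / \<Delta> T\<rfloor>"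
abbreviation "law T \<equiv> incr_pmf \<theta> (\<Delta> T)"

lemma n_Delta:
  assumes "T > 0" shows "real (n T) * \<Delta> T \<le> T" "T - \<Delta> T \<le> real (n T) * \<Delta> T"
proof -
  have D: "\<Delta> T > 0" using Delta[OF assms] by simp
  have "real (n T) = of_int \<lfloor>T / \<Delta> T\<rfloor>" using D assms by simp
  then have "real (n T) \<le> T / \<Delta> T" "T / \<Delta> T - 1 \<le> real (n T)" by linarith+
  then show "real (n T) * \<Delta> T \<le> T" "T - \<Delta> T \<le> real (n T) * \<Delta> T"
    using D by (auto simp: field_simps)
qed

text \<open>The stretch after the last grid point is no longer than one sampling step, so the
  observed time is asymptotically \<open>T\<close>.\<close>

lemma n_Delta_tendsto: "((\<lambda>T. real (n T) * \<Delta> T / T) \<longlongrightarrow> 1) at_top"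
proof (rule tendsto_sandwich)
  show "\<forall>\<^sub>F T in at_top. 1 - \<Delta> T / T \<le> real (n T) * \<Delta> T / T"
    using eventually_gt_at_top[of 0]
  proof eventually_elim
    case (elim T)
    then have "(T - \<Delta> T) / T \<le> real (n T) * \<Delta> T / T" using n_Delta(2) by (intro divide_right_mono) auto
    then show ?case using elim by (simp add: diff_divide_distrib)
  qed
  show "\<forall>\<^sub>F T in at_top. real (n T) * \<Delta> T / T \<le> 1"
    using eventually_gt_at_top[of 0] by eventually_elim (use n_Delta(1) in auto)
  have "((\<lambda>T::real. 1 / T) \<longlongrightarrow> 0) at_top" by real_asymp
  then have "((\<lambda>T. 1 - \<Delta> T * (1 / T)) \<longlongrightarrow> 1 - 0 * 0) at_top" by (intro tendsto_intros Delta_tendsto)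
  then show "((\<lambda>T. 1 - \<Delta> T / T) \<longlongrightarrow> 1) at_top" by simp
qed simp

lemma eventually_Delta_le: "c > 0 \<Longrightarrow> \<forall>\<^sub>F T in at_top. \<Delta> T \<le> c"
  using eventually_mono[OF order_tendstoD(2)[OF Delta_tendsto], of c] by (simp add: less_imp_le)

lemma eventually_good: "\<forall>\<^sub>F T in at_top. T > 0 \<and> \<Delta> T > 0 \<and> \<Delta> T \<le> 1 \<and> \<theta> * \<Delta> T \<le> 1"
proof -
  have "\<forall>\<^sub>F T in at_top. \<Delta> T \<le> min 1 (1 / \<theta>)"
    using theta_pos by (intro eventually_Delta_le) simp
  with eventually_gt_at_top[of "0::real"] show ?thesis
  proof eventually_elim
    case (elim T)
    then show ?case using Delta[of T] theta_pos by (simp add: field_simps)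
  qed
qed

text \<open>LAN demands one central sequence for all \<open>v\<close>, so \<open>v\<close> does not
  occur here.\<close>

definition xi :: "real \<Rightarrow> int list \<Rightarrow> real" where
  "xi T ys = sum_list (map (\<lambda>k. centred_abs \<theta> (\<Delta> T) k / sqrt (\<theta> * T)) (increments ys))"

lemma xi_tendsto:
  "conv_distr_at_top (\<lambda>T. distr (measure_pmf (obs_pmf T (\<Delta> T) \<theta>)) borel (xi T)) std_normal_distribution"
proof -
  let ?f = "\<lambda>T k. centred_abs \<theta> (\<Delta> T) k / sqrt (\<theta> * T)"
  let ?v = "\<lambda>T. measure_pmf.expectation (law T) (\<lambda>x. (?f T x)\<^sup>2)"
  let ?e3 = "\<lambda>T. measure_pmf.expectation (law T) (\<lambda>x. \<bar>?f T x\<bar> ^ 3)"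
  let ?C = "cube_exp_const + 1"
  have good: "\<forall>\<^sub>F T in at_top. T > 0 \<and> \<theta> * \<Delta> T > 0 \<and> \<theta> * \<Delta> T \<le> 1"
    using eventually_good by eventually_elim (use theta_pos in auto)
  have f2: "(?f T k)\<^sup>2 = (centred_abs \<theta> (\<Delta> T) k)\<^sup>2 / (\<theta> * T)" if "T > 0" for T k
    using that theta_pos by (simp add: power_divide)
  have f3: "\<bar>?f T k\<bar> ^ 3 = \<bar>centred_abs \<theta> (\<Delta> T) k\<bar> ^ 3 / sqrt (\<theta> * T) ^ 3" if "T > 0" for T k
    using that theta_pos by (simp add: abs_divide power_divide)
  have C: "?C \<ge> 0" using cube_exp_const_nonneg by simp
  have nv: "((\<lambda>T. real (n T) * ?v T) \<longlongrightarrow> 1) at_top"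
  proof -
    \<comment> \<open>The discrepancy is the squared mean of the absolute increment; summed and
      normalised it is at most \<open>\<theta> * \<Delta> T\<close>.\<close>
    have "((\<lambda>T. real (n T) * ?v T - real (n T) * \<Delta> T / T) \<longlongrightarrow> 0) at_top"
    proof (rule Lim_null_comparison)
      show "\<forall>\<^sub>F T in at_top. norm (real (n T) * ?v T - real (n T) * \<Delta> T / T) \<le> \<theta> * \<Delta> T"
        using good
      proof eventually_elim
        case (elim T)
        let ?V = "measure_pmf.expectation (law T) (\<lambda>x. (centred_abs \<theta> (\<Delta> T) x)\<^sup>2)"
        have "real (n T) * ?v T - real (n T) * \<Delta> T / T = real (n T) * (?V - \<theta> * \<Delta> T) / (\<theta> * T)"
          using elim theta_pos by (simp add: f2 field_simps)
        also have "norm \<dots> = real (n T) * \<bar>?V - \<theta> * \<Delta> T\<bar> / (\<theta> * T)"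
          using elim theta_pos by (simp add: abs_mult)
        also have "\<dots> \<le> real (n T) * (\<theta> * \<Delta> T)\<^sup>2 / (\<theta> * T)"
          using elim theta_pos expectation_centred_abs_square[of \<theta> "\<Delta> T"]
          by (intro divide_right_mono mult_left_mono) auto
        also have "\<dots> = \<theta> * \<Delta> T * (real (n T) * \<Delta> T) / T"
          using elim theta_pos by (simp add: power2_eq_square field_simps)
        also have "\<dots> \<le> \<theta> * \<Delta> T * T / T"
          using elim n_Delta(1)[of T] by (intro divide_right_mono mult_left_mono) auto
        finally show ?case using elim by simp
      qed
      show "((\<lambda>T. \<theta> * \<Delta> T) \<longlongrightarrow> 0) at_top"
        using tendsto_mult[OF tendsto_const Delta_tendsto, of \<theta>] by simp
    qed
    from tendsto_add[OF this n_Delta_tendsto] show ?thesis by simp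
  qed
  have v0: "(?v \<longlongrightarrow> 0) at_top"
  proof (rule Lim_null_comparison)
    show "\<forall>\<^sub>F T in at_top. norm (?v T) \<le> 2 / (\<theta> * T)"
      using good
    proof eventually_elim
      case (elim T)
      have "(\<theta> * \<Delta> T)\<^sup>2 \<le> 1" using elim by (intro power_le_one) auto
      then have "measure_pmf.expectation (law T) (\<lambda>x. (centred_abs \<theta> (\<Delta> T) x)\<^sup>2) \<le> 2"
        using expectation_centred_abs_square[of \<theta> "\<Delta> T"] elim by linarith
      then show ?case using elim theta_pos by (simp add: f2 divide_right_mono)
    qed
    show "((\<lambda>T. 2 / (\<theta> * T)) \<longlongrightarrow> 0) at_top" using theta_pos by real_asymp
  qed
  \<comment> \<open>The third moments sum to order \<open>\<theta> * T\<close>, the normalisation is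
    \<open>sqrt (\<theta> * T) ^ 3\<close>: the Lyapunov ratio is of order
    \<open>1 / sqrt T\<close>.\<close>
  have ne3: "((\<lambda>T. real (n T) * ?e3 T) \<longlongrightarrow> 0) at_top"
  proof (rule Lim_null_comparison)
    show "\<forall>\<^sub>F T in at_top. norm (real (n T) * ?e3 T) \<le> ?C * \<theta> * T / sqrt (\<theta> * T) ^ 3"
      using good
    proof eventually_elim
      case (elim T)
      have "norm (real (n T) * ?e3 T) = real (n T) * ?e3 T" by simp
      also have "\<dots> \<le> real (n T) * (?C * (\<theta> * \<Delta> T) / sqrt (\<theta> * T) ^ 3)"
      proof -
        have "?e3 T = measure_pmf.expectation (law T) (\<lambda>k. \<bar>centred_abs \<theta> (\<Delta> T) k\<bar> ^ 3) / sqrt (\<theta> * T) ^ 3"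
          using elim by (simp only: f3 integral_divide_zero)
        also have "\<dots> \<le> ?C * (\<theta> * \<Delta> T) / sqrt (\<theta> * T) ^ 3"
          using elim theta_pos by (intro divide_right_mono expectation_centred_abs_cube) auto
        finally show ?thesis by (intro mult_left_mono) auto
      qed
      also have "\<dots> = ?C * \<theta> * (real (n T) * \<Delta> T) / sqrt (\<theta> * T) ^ 3" by simp
      also have "\<dots> \<le> ?C * \<theta> * T / sqrt (\<theta> * T) ^ 3"
        using elim n_Delta(1)[of T] C theta_pos by (intro divide_right_mono mult_left_mono) auto
      finally show ?case .
    qed
    show "((\<lambda>T. ?C * \<theta> * T / sqrt (\<theta> * T) ^ 3) \<longlongrightarrow> 0) at_top"
      using theta_pos C by real_asymp
  qed
  have "conv_distr_at_top
    (\<lambda>T. distr (measure_pmf (replicate_pmf (n T) (law T))) borel (\<lambda>xs. sum_list (map (?f T) xs))) std_normal_distribution"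
  proof (rule replicate_pmf_clt[OF _ _ _ _ nv v0 ne3])
    show "\<forall>\<^sub>F T in at_top. integrable (measure_pmf (law T)) (?f T)"
      using good by eventually_elim (use integrable_centred_abs in auto)
    show "\<forall>\<^sub>F T in at_top. integrable (measure_pmf (law T)) (\<lambda>x. (?f T x)\<^sup>2)"
      using good by eventually_elim (use integrable_centred_abs_square in \<open>auto simp: f2\<close>)
    show "\<forall>\<^sub>F T in at_top. integrable (measure_pmf (law T)) (\<lambda>x. \<bar>?f T x\<bar> ^ 3)"
      using good by eventually_elim (simp only: f3, simp add: integrable_centred_abs_cube)
    show "\<forall>\<^sub>F T in at_top. measure_pmf.expectation (law T) (?f T) = 0"
      using good by eventually_elim (use expectation_centred_abs in auto)
  qed
  moreover have "distr (measure_pmf (obs_pmf T (\<Delta> T) \<theta>)) borel (xi T)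
      = distr (measure_pmf (replicate_pmf (n T) (law T))) borel (\<lambda>xs. sum_list (map (?f T) xs))" for T
    unfolding obs_pmf_def map_pmf_rep_eq by (subst distr_distr) (auto simp: comp_def xi_def)
  ultimately show ?thesis by simp
qed

context
  fixes v :: real
begin

abbreviation "\<theta>' T \<equiv> \<theta> + v / sqrt (T / \<theta>)"

text \<open>Solving the LAN expansion for its error term makes the likelihood identity exact; only
  convergence is left to prove.\<close>

definition remainder :: "real \<Rightarrow> int list \<Rightarrow> real" where
  "remainder T ys = sum_list (map (log_ratio (\<Delta> T) \<theta> (\<theta>' T)) (increments ys)) - v * xi T ys + v\<^sup>2 / 2"

lemma remainder_correct:
  assumes "T > 0" "\<theta>' T > 0"
  shows "AE ys in measure_pmf (obs_pmf T (\<Delta> T) \<theta>).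
    pmf (obs_pmf T (\<Delta> T) (\<theta>' T)) ys / pmf (obs_pmf T (\<Delta> T) \<theta>) ys
      = exp (v * xi T ys - v\<^sup>2 / 2 + remainder T ys)"
proof (rule AE_pmfI)
  fix ys assume "ys \<in> set_pmf (obs_pmf T (\<Delta> T) \<theta>)"
  then obtain xs where xs: "length xs = n T" "ys = partial_sums xs"
    unfolding obs_pmf_def by (auto simp: set_replicate_pmf)
  have "\<theta> * \<Delta> T > 0" "\<theta>' T * \<Delta> T > 0" using assms theta_pos Delta[of T] by auto
  then show "pmf (obs_pmf T (\<Delta> T) (\<theta>' T)) ys / pmf (obs_pmf T (\<Delta> T) \<theta>) ys
      = exp (v * xi T ys - v\<^sup>2 / 2 + remainder T ys)"
    using xs by (simp add: obs_pmf_ratio remainder_def)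
qed

abbreviation "dev T \<equiv> \<theta>' T - \<theta>"

lemma dev_square: "T > 0 \<Longrightarrow> (dev T)\<^sup>2 = v\<^sup>2 * \<theta> / T"
  using theta_pos by (simp add: power_divide)

lemma dev_tendsto: "((\<lambda>T. dev T) \<longlongrightarrow> 0) at_top"
  using theta_pos by real_asymp

lemma eventually_local_shift: "\<forall>\<^sub>F T in at_top. T > 0 \<and> local_shift \<theta> (\<theta>' T) (\<Delta> T)"
proof -
  have "((\<lambda>T. 2 * \<bar>dev T\<bar>) \<longlongrightarrow> 2 * \<bar>0\<bar>) at_top" by (intro tendsto_intros dev_tendsto)
  then have "\<forall>\<^sub>F T in at_top. 2 * \<bar>dev T\<bar> < min \<theta> 1"
    by (rule order_tendstoD(2)) (use theta_pos in auto)
  with eventually_good show ?thesis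
    by eventually_elim (use theta_pos in \<open>auto simp: local_shift_def\<close>)
qed

abbreviation "LR T \<equiv> log_ratio (\<Delta> T) \<theta> (\<theta>' T)"
abbreviation "EL T \<equiv> measure_pmf.expectation (law T) (LR T)"

text \<open>By \<open>E_L\<close> the mean is \<open>- lam^2 * \<theta> * \<Delta> / 2\<close> up to
  errors that sum to order \<open>T * u^2 * \<Delta>\<close> and \<open>T * \<bar>u\<bar>^3\<close>.
  Both vanish, as \<open>T * u^2\<close> is the constant \<open>v^2 * \<theta>\<close>.\<close>

lemma drift_tendsto: "((\<lambda>T. real (n T) * EL T) \<longlongrightarrow> - v\<^sup>2 / 2) at_top"
proof -
  let ?lam = "\<lambda>T. ln (\<theta>' T / \<theta>)"
  \<comment> \<open>Outside its locale the constant depends on \<open>\<theta>\<close> alone, so it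
    is uniform in \<open>T\<close>. Its absolute value is used below to keep the bracket nonnegative
    when \<open>n * \<Delta>\<close> is replaced by \<open>T\<close>.\<close>
  define K where "K = local_shift.drift_const \<theta>"
  have lam: "((\<lambda>T. \<theta> * T * (?lam T)\<^sup>2) \<longlongrightarrow> v\<^sup>2) at_top"
  proof -
    have "((\<lambda>T. sqrt (\<theta> * T) * ln (1 + v / sqrt (\<theta> * T))) \<longlongrightarrow> v) at_top"
      using theta_pos by real_asymp
    then have "((\<lambda>T. (sqrt (\<theta> * T) * ln (1 + v / sqrt (\<theta> * T)))\<^sup>2) \<longlongrightarrow> v\<^sup>2) at_top"
      by (intro tendsto_intros)
    moreover have "\<forall>\<^sub>F T in at_top. (sqrt (\<theta> * T) * ln (1 + v / sqrt (\<theta> * T)))\<^sup>2 = \<theta> * T * (?lam T)\<^sup>2"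
      using eventually_gt_at_top[of 0]
    proof eventually_elim
      case (elim T)
      have "\<theta>' T / \<theta> = 1 + v / sqrt (\<theta> * T)"
        using elim theta_pos by (simp add: real_sqrt_divide real_sqrt_mult field_simps)
      then show ?case using elim theta_pos by (simp add: power_mult_distrib)
    qed
    ultimately show ?thesis by (rule Lim_transform_eventually)
  qed
  have main: "((\<lambda>T. (real (n T) * \<Delta> T / T) * (\<theta> * T * (?lam T)\<^sup>2) / 2) \<longlongrightarrow> 1 * v\<^sup>2 / 2) at_top"
    by (intro tendsto_intros n_Delta_tendsto lam) simp
  have "((\<lambda>T. real (n T) * EL T + (real (n T) * \<Delta> T / T) * (\<theta> * T * (?lam T)\<^sup>2) / 2) \<longlongrightarrow> 0) at_top"
  proof (rule Lim_null_comparison)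
    show "\<forall>\<^sub>F T in at_top. norm (real (n T) * EL T + (real (n T) * \<Delta> T / T) * (\<theta> * T * (?lam T)\<^sup>2) / 2)
        \<le> 6 * v\<^sup>2 * \<theta> * \<Delta> T + 2 * \<bar>K\<bar> * (T * \<bar>dev T\<bar> ^ 3)"
      using eventually_local_shift
    proof eventually_elim
      case (elim T)
      then interpret local_shift \<theta> "\<theta>' T" "\<Delta> T" by simp
      have T: "T > 0" using elim by simp
      have "norm (real (n T) * EL T + (real (n T) * \<Delta> T / T) * (\<theta> * T * (?lam T)\<^sup>2) / 2)
          = real (n T) * \<bar>EL T + (?lam T)\<^sup>2 * (\<theta> * \<Delta> T) / 2\<bar>"
      proof -
        have "real (n T) * EL T + (real (n T) * \<Delta> T / T) * (\<theta> * T * (?lam T)\<^sup>2) / 2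
            = real (n T) * (EL T + (?lam T)\<^sup>2 * (\<theta> * \<Delta> T) / 2)"
          using T by (simp add: field_simps)
        then show ?thesis by (simp only: real_norm_def abs_mult abs_of_nat)
      qed
      also have "\<dots> \<le> real (n T) * (6 * (dev T)\<^sup>2 * (\<Delta> T)\<^sup>2 + 2 * K * \<bar>dev T\<bar>^3 * \<Delta> T)"
        unfolding K_def by (intro mult_left_mono E_L) simp
      also have "\<dots> = (real (n T) * \<Delta> T) * (6 * (dev T)\<^sup>2 * \<Delta> T + 2 * K * \<bar>dev T\<bar>^3)"
        by (simp add: algebra_simps power2_eq_square)
      also have "\<dots> \<le> (real (n T) * \<Delta> T) * (6 * (dev T)\<^sup>2 * \<Delta> T + 2 * \<bar>K\<bar> * \<bar>dev T\<bar>^3)"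
        using Delta_pos by (intro mult_left_mono add_mono mult_right_mono) auto
      also have "\<dots> \<le> T * (6 * (dev T)\<^sup>2 * \<Delta> T + 2 * \<bar>K\<bar> * \<bar>dev T\<bar>^3)"
        using Delta_pos n_Delta(1)[OF T] by (intro mult_right_mono) auto
      also have "\<dots> = 6 * v\<^sup>2 * \<theta> * \<Delta> T + 2 * \<bar>K\<bar> * (T * \<bar>dev T\<bar> ^ 3)"
        unfolding dev_square[OF T] using T by (simp add: field_simps)
      finally show ?case .
    qed
    have "((\<lambda>T. T * \<bar>dev T\<bar> ^ 3) \<longlongrightarrow> 0) at_top"
    proof (rule Lim_transform_eventually)
      show "((\<lambda>T. v\<^sup>2 * \<theta> * \<bar>dev T\<bar>) \<longlongrightarrow> 0) at_top"
        using tendsto_mult[OF tendsto_const tendsto_rabs[OF dev_tendsto], of "v\<^sup>2 * \<theta>"] by simp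
      show "\<forall>\<^sub>F T in at_top. v\<^sup>2 * \<theta> * \<bar>dev T\<bar> = T * \<bar>dev T\<bar> ^ 3"
        using eventually_gt_at_top[of 0]
      proof eventually_elim
        case (elim T)
        have "\<bar>dev T\<bar> ^ 3 = (dev T)\<^sup>2 * \<bar>dev T\<bar>" by (simp add: power3_eq_cube power2_eq_square)
        then show ?case unfolding dev_square[OF elim] using elim by simp
      qed
    qed
    then have "((\<lambda>T. 6 * v\<^sup>2 * \<theta> * \<Delta> T + 2 * \<bar>K\<bar> * (T * \<bar>dev T\<bar> ^ 3)) \<longlongrightarrow> 6 * v\<^sup>2 * \<theta> * 0 + 2 * \<bar>K\<bar> * 0) at_top"
      by (intro tendsto_intros Delta_tendsto)
    then show "((\<lambda>T. 6 * v\<^sup>2 * \<theta> * \<Delta> T + 2 * \<bar>K\<bar> * (T * \<bar>dev T\<bar> ^ 3)) \<longlongrightarrow> 0) at_top" by simp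
  qed
  from tendsto_diff[OF this main] show ?thesis by simp
qed

text \<open>The remainder is the sum of the centred \<open>R\<close> plus a deterministic drift
  error. The latter is eventually below \<open>\<epsilon> / 2\<close>, which leaves
  \<open>\<epsilon> / 2\<close> for Chebyshev's inequality.\<close>

lemma remainder_tendsto: "conv_prob_zero_at_top (\<lambda>T. obs_pmf T (\<Delta> T) \<theta>) remainder"
  unfolding conv_prob_zero_at_top_def
proof (intro allI impI)
  fix \<epsilon> :: real assume eps: "\<epsilon> > 0"
  show "((\<lambda>T. measure_pmf.prob (obs_pmf T (\<Delta> T) \<theta>) {ys. \<bar>remainder T ys\<bar> > \<epsilon>}) \<longlongrightarrow> 0) at_top"
  proof (rule Lim_null_comparison)
    have "((\<lambda>T. real (n T) * EL T + v\<^sup>2 / 2) \<longlongrightarrow> - v\<^sup>2 / 2 + v\<^sup>2 / 2) at_top"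
      by (intro tendsto_intros drift_tendsto)
    then have "((\<lambda>T. \<bar>real (n T) * EL T + v\<^sup>2 / 2\<bar>) \<longlongrightarrow> \<bar>- v\<^sup>2 / 2 + v\<^sup>2 / 2\<bar>) at_top"
      by (rule tendsto_rabs)
    then have drift: "\<forall>\<^sub>F T in at_top. \<bar>real (n T) * EL T + v\<^sup>2 / 2\<bar> < \<epsilon> / 2"
      by (rule order_tendstoD(2)) (use eps in auto)
    \<comment> \<open>This is \<open>T / \<Delta>\<close> times the bound \<open>E_R2\<close>, with
      \<open>u^2 = v^2 * \<theta> / T\<close> inserted, over the squared threshold.\<close>
    let ?b = "\<lambda>T. (8 * v ^ 4 / (\<theta> * T) + 8 * v\<^sup>2 * \<theta> * \<Delta> T) / (\<epsilon> / 2)\<^sup>2"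
    show "\<forall>\<^sub>F T in at_top. norm (measure_pmf.prob (obs_pmf T (\<Delta> T) \<theta>) {ys. \<bar>remainder T ys\<bar> > \<epsilon>}) \<le> ?b T"
      using drift eventually_local_shift
    proof eventually_elim
      case (elim T)
      then interpret local_shift \<theta> "\<theta>' T" "\<Delta> T" by simp
      have T: "T > 0" using elim by simp
      let ?Q = "replicate_pmf (n T) (law T)"
      have scale: "v / sqrt (\<theta> * T) = dev T / \<theta>"
        using T theta_pos by (simp add: real_sqrt_divide real_sqrt_mult field_simps)
      have rem: "remainder T (partial_sums xs) = sum_list (map R xs) + (real (n T) * EL T + v\<^sup>2 / 2)"
        if "length xs = n T" for xs
      proof -
        have "v * xi T (partial_sums xs) = dev T / \<theta> * sum_list (map (centred_abs \<theta> (\<Delta> T)) xs)"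
          unfolding xi_def increments_partial_sums scale[symmetric]
          by (simp add: sum_list_const_mult[symmetric] divide_inverse mult_ac)
        moreover have "R = (\<lambda>k. (LR T k - EL T) - dev T / \<theta> * centred_abs \<theta> (\<Delta> T) k)"
          by (simp add: fun_eq_iff R_def centred_abs_def)
        then have "sum_list (map R xs) = sum_list (map (LR T) xs) - n T * EL T
            - dev T / \<theta> * sum_list (map (centred_abs \<theta> (\<Delta> T)) xs)"
          using sum_list_map_affine[of "LR T" "EL T" "dev T / \<theta>" "centred_abs \<theta> (\<Delta> T)" xs]
          by (simp only: that)
        ultimately show ?thesis
          unfolding remainder_def increments_partial_sums by linarith
      qed
      have "measure_pmf.prob (obs_pmf T (\<Delta> T) \<theta>) {ys. \<bar>remainder T ys\<bar> > \<epsilon>}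
          = measure_pmf.prob ?Q {xs. \<bar>remainder T (partial_sums xs)\<bar> > \<epsilon>}"
        unfolding obs_pmf_def by (simp add: vimage_def)
      also have "\<dots> \<le> measure_pmf.prob ?Q {xs. \<bar>sum_list (map R xs)\<bar> > \<epsilon> / 2}"
      \<comment> \<open>The decomposition \<open>rem\<close> needs lists of length
        \<open>n T\<close>, so the events are compared only on the support.\<close>
      proof (rule measure_pmf.finite_measure_mono_AE)
        show "AE xs in ?Q. xs \<in> {xs. \<bar>remainder T (partial_sums xs)\<bar> > \<epsilon>} \<longrightarrow> xs \<in> {xs. \<bar>sum_list (map R xs)\<bar> > \<epsilon> / 2}"
        proof (rule AE_pmfI)
          fix xs assume "xs \<in> set_pmf ?Q"
          then have "length xs = n T" by (auto simp: set_replicate_pmf)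
          from rem[OF this] show "xs \<in> {xs. \<bar>remainder T (partial_sums xs)\<bar> > \<epsilon>} \<longrightarrow> xs \<in> {xs. \<bar>sum_list (map R xs)\<bar> > \<epsilon> / 2}"
            using elim(1) abs_triangle_ineq[of "sum_list (map R xs)" "real (n T) * EL T + v\<^sup>2 / 2"]
            unfolding mem_Collect_eq by linarith
        qed
      qed simp
      also have "\<dots> \<le> real (n T) * E (\<lambda>k. (R k)\<^sup>2) / (\<epsilon> / 2)\<^sup>2"
        using eps by (intro replicate_pmf_chebyshev integrable_R integrable_R2 E_R) simp
      also have "\<dots> \<le> real (n T) * (8 * (dev T / \<theta>)^4 * (\<theta> * \<Delta> T) + 8 * (dev T)\<^sup>2 * (\<Delta> T)\<^sup>2) / (\<epsilon> / 2)\<^sup>2"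
        using E_R2 by (intro divide_right_mono mult_left_mono) auto
      also have "\<dots> = (real (n T) * \<Delta> T) * (8 * (dev T / \<theta>)^4 * \<theta> + 8 * (dev T)\<^sup>2 * \<Delta> T) / (\<epsilon> / 2)\<^sup>2"
        by (simp add: algebra_simps power2_eq_square)
      also have "\<dots> \<le> T * (8 * (dev T / \<theta>)^4 * \<theta> + 8 * (dev T)\<^sup>2 * \<Delta> T) / (\<epsilon> / 2)\<^sup>2"
        using n_Delta(1)[OF T] Delta_pos theta_pos by (intro divide_right_mono mult_right_mono) auto
      also have "(dev T / \<theta>)^4 = ((dev T)\<^sup>2)\<^sup>2 / \<theta>^4"
        by (simp only: power_divide power_mult[symmetric]) simp
      also have "T * (8 * (((dev T)\<^sup>2)\<^sup>2 / \<theta>^4) * \<theta> + 8 * (dev T)\<^sup>2 * \<Delta> T) = 8 * v ^ 4 / (\<theta> * T) + 8 * v\<^sup>2 * \<theta> * \<Delta> T"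
        unfolding dev_square[OF T] using T theta_pos by (simp add: field_simps power2_eq_square power4_eq_xxxx)
      finally show ?case by simp
    qed
    have "((\<lambda>T. 8 * v ^ 4 / (\<theta> * T)) \<longlongrightarrow> 0) at_top" using theta_pos by real_asymp
    then have "(?b \<longlongrightarrow> (0 + 8 * v\<^sup>2 * \<theta> * 0) / (\<epsilon> / 2)\<^sup>2) at_top"
      using eps by (intro tendsto_intros Delta_tendsto) auto
    then show "(?b \<longlongrightarrow> 0) at_top" by simp
  qed
qed

end

lemma LAN_obs_pmf:
  assumes "\<Theta> \<subseteq> {0<..}"
  shows "LAN (\<lambda>T \<theta>'. obs_pmf T (\<Delta> T) \<theta>') \<Theta> \<theta> (\<lambda>T. T / \<theta>)"
  unfolding LAN_def
proof (intro conjI exI allI)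
  show "conv_distr_at_top (\<lambda>T. distr (measure_pmf (obs_pmf T (\<Delta> T) \<theta>)) borel (xi T)) std_normal_distribution"
    by (rule xi_tendsto)
  show "conv_prob_zero_at_top (\<lambda>T. obs_pmf T (\<Delta> T) \<theta>) (remainder v)" for v
    by (rule remainder_tendsto)
qed (use remainder_correct assms theta_pos in auto)

end

theorem theorem2:
  fixes \<Theta> :: "real set" and \<Delta> :: "real \<Rightarrow> real"
  assumes "open \<Theta>" and "\<Theta> \<subseteq> {0<..}"
    and "\<And>T. T > 0 \<Longrightarrow> 0 < \<Delta> T \<and> \<Delta> T \<le> T"
    and "(\<Delta> \<longlongrightarrow> 0) at_top"
  shows "\<forall>\<theta>\<in>\<Theta>.
           LAN (\<lambda>T \<theta>'. obs_pmf T (\<Delta> T) \<theta>') \<Theta> \<theta> (\<lambda>T. T / \<theta>) \<and>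
           (\<forall>T>0. ((\<lambda>d. T * d * phi \<theta> d) \<longlongrightarrow> T / \<theta>) (at_right 0))"
proof (intro ballI conjI allI impI)
  fix \<theta> assume "\<theta> \<in> \<Theta>"
  then have "\<theta> > 0" using assms(2) by auto
  then interpret high_frequency \<theta> \<Delta> using assms by unfold_locales auto
  show "LAN (\<lambda>T \<theta>'. obs_pmf T (\<Delta> T) \<theta>') \<Theta> \<theta> (\<lambda>T. T / \<theta>)"
    by (rule LAN_obs_pmf) fact
  show "((\<lambda>d. T * d * phi \<theta> d) \<longlongrightarrow> T / \<theta>) (at_right 0)" for T
    by (rule tendsto_phi) fact
qed

end
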